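(* Let $H$ be an infinite-dimensional complex Hilbert space and let $T\in\mathcal{B}(H)$ be a positive operator. Then $T$ is absolutely minimum attaining, i.e. $T\in\mathcal{AM}(H)$, if and only if the essential spectrum $\sigma_{ess}(T)$ is a singleton and the interval $(m_e(T),\|T\|]$ contains only finitely many eigenvalues of $T$.
   Context: $\mathcal{B}(H)$ is the space of bounded linear operators on $H$. $T\in\mathcal{B}(H)$ is positive if $T=T^*$ and $\langle Tx,x\rangle\ge 0$ for all $x\in H$. A bounded operator $S:H_1\to H_2$ between Hilbert spaces is minimum attaining if there is a unit vector $x\in H_1$ with $\|Sx\|=m(S)$, where $m(S)=\inf\{\|Sx\|:x\in H_1,\ \|x\|=1\}$. $T\in\mathcal{B}(H)$ is absolutely minimum attaining, written $T\in\mathcal{AM}(H)$, if for every nonzero closed subspace $M\subseteq H$ the restriction $T|_M:M\to H$ is minimum attaining. For self-adjoint $T$, the discrete spectrum $\sigma_d(T)$ is the set of isolated points of $\sigma(T)$ that are eigenvalues of finite multiplicity, and $\sigma_{ess}(T)=\sigma(T)\setminus\sigma_d(T)$. The essential minimum modulus of such $T$ is $m_e(T)=\inf\{|\lambda|:\lambda\in\sigma_{ess}(T)\}$. *)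

theory Defs
  imports "HOL-Analysis.Analysis"
begin

section \<open>Complex Hilbert spaces\<close>

class complex_vector = real_vector +
  fixes scaleC :: "complex \<Rightarrow> 'a \<Rightarrow> 'a"  (infixr \<open>*\<^sub>C\<close> 75)
  assumes scaleC_add_right: "a *\<^sub>C (x + y) = a *\<^sub>C x + a *\<^sub>C y"
    and scaleC_add_left: "(a + b) *\<^sub>C x = a *\<^sub>C x + b *\<^sub>C x"
    and scaleC_scaleC: "a *\<^sub>C (b *\<^sub>C x) = (a * b) *\<^sub>C x"
    and scaleC_one: "1 *\<^sub>C x = x"
    and scaleR_scaleC: "r *\<^sub>R x = complex_of_real r *\<^sub>C x"

global_interpretation complex_vector:
  vector_space "scaleC :: complex \<Rightarrow> 'a \<Rightarrow> 'a :: complex_vector"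
  by unfold_locales
    (rule scaleC_add_right scaleC_add_left scaleC_scaleC scaleC_one)+

abbreviation csubspace :: "'a::complex_vector set \<Rightarrow> bool"
  where "csubspace \<equiv> complex_vector.subspace"

abbreviation cspan :: "'a::complex_vector set \<Rightarrow> 'a set"
  where "cspan \<equiv> complex_vector.span"

text \<open>
  The class \<^class>\<open>real_inner\<close> supplies the norm and the topology. Its real inner product is the
  real part of the complex one, so \<open>norm x = sqrt (Re (cinner x x))\<close>, and positive definiteness of
  \<open>cinner\<close> is inherited. The complex inner product is linear in its first argument.
\<close>

class complex_inner = complex_vector + real_inner +
  fixes cinner :: "'a \<Rightarrow> 'a \<Rightarrow> complex"
  assumes cinner_commute: "cinner x y = cnj (cinner y x)"
    and cinner_add_left: "cinner (x + y) z = cinner x z + cinner y z"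
    and cinner_scaleC_left: "cinner (c *\<^sub>C x) y = c * cinner x y"
    and inner_eq_Re_cinner: "inner x y = Re (cinner x y)"

class chilbert_space = complex_inner + complete_space

text \<open>
  Meant for subspaces. The function \<open>complex_vector.dim\<close> cannot be used to express finite
  dimensionality, since it is \<open>0\<close> on infinite-dimensional spaces.
\<close>

definition cfinite_dim :: "'a::complex_vector set \<Rightarrow> bool"
  where "cfinite_dim M \<longleftrightarrow> (\<exists>B. finite B \<and> cspan B = M)"


section \<open>Bounded operators and their spectra\<close>

definition bounded_clinear :: "('a::complex_inner \<Rightarrow> 'b::complex_inner) \<Rightarrow> bool"
  where "bounded_clinear T \<longleftrightarrow> bounded_linear T \<and> (\<forall>c x. T (c *\<^sub>C x) = c *\<^sub>C T x)"

definition is_cadjoint :: "('b::complex_inner \<Rightarrow> 'a::complex_inner) \<Rightarrow> ('a \<Rightarrow> 'b) \<Rightarrow> bool"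
  where "is_cadjoint S T \<longleftrightarrow> (\<forall>x y. cinner (T x) y = cinner x (S y))"

definition selfadjoint :: "('a::complex_inner \<Rightarrow> 'a) \<Rightarrow> bool"
  where "selfadjoint T \<longleftrightarrow> is_cadjoint T T"

definition positive_op :: "('a::complex_inner \<Rightarrow> 'a) \<Rightarrow> bool"
  where "positive_op T \<longleftrightarrow> selfadjoint T \<and> (\<forall>x. cinner (T x) x \<in> \<real>\<^sub>\<ge>\<^sub>0)"

definition invertible_op :: "('a::complex_inner \<Rightarrow> 'a) \<Rightarrow> bool"
  where "invertible_op T \<longleftrightarrow> (\<exists>S. bounded_clinear S \<and> S \<circ> T = id \<and> T \<circ> S = id)"

definition spectrum_op :: "('a::complex_inner \<Rightarrow> 'a) \<Rightarrow> complex set"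
  where "spectrum_op T = {\<mu>. \<not> invertible_op (\<lambda>x. T x - \<mu> *\<^sub>C x)}"

definition eigenspace_op :: "('a::complex_inner \<Rightarrow> 'a) \<Rightarrow> complex \<Rightarrow> 'a set"
  where "eigenspace_op T \<mu> = {x. T x = \<mu> *\<^sub>C x}"

definition eigenvalue_op :: "('a::complex_inner \<Rightarrow> 'a) \<Rightarrow> complex \<Rightarrow> bool"
  where "eigenvalue_op T \<mu> \<longleftrightarrow> (\<exists>x. x \<noteq> 0 \<and> T x = \<mu> *\<^sub>C x)"

text \<open>
  The following three notions are used for self-adjoint \<open>T\<close> only.
\<close>

definition discrete_spectrum :: "('a::complex_inner \<Rightarrow> 'a) \<Rightarrow> complex set"
  where "discrete_spectrum T =
    {\<mu>. \<mu> isolated_in spectrum_op T \<and> eigenvalue_op T \<mu> \<and> cfinite_dim (eigenspace_op T \<mu>)}"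

definition essential_spectrum :: "('a::complex_inner \<Rightarrow> 'a) \<Rightarrow> complex set"
  where "essential_spectrum T = spectrum_op T - discrete_spectrum T"

definition ess_min_modulus :: "('a::complex_inner \<Rightarrow> 'a) \<Rightarrow> real"
  where "ess_min_modulus T = (INF \<mu>\<in>essential_spectrum T. cmod \<mu>)"


section \<open>Absolutely minimum attaining operators\<close>

text \<open>
  The restriction of \<open>T\<close> to a subspace \<open>M\<close> is represented by the pair of \<open>M\<close> and \<open>T\<close>. The infimum
  is only meaningful for \<open>M \<noteq> {0}\<close>.
\<close>

definition min_modulus_on :: "'a::complex_inner set \<Rightarrow> ('a \<Rightarrow> 'b::complex_inner) \<Rightarrow> real"
  where "min_modulus_on M T = Inf {norm (T x) | x. x \<in> M \<and> norm x = 1}"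

definition min_attaining_on :: "'a::complex_inner set \<Rightarrow> ('a \<Rightarrow> 'b::complex_inner) \<Rightarrow> bool"
  where "min_attaining_on M T \<longleftrightarrow> (\<exists>x\<in>M. norm x = 1 \<and> norm (T x) = min_modulus_on M T)"

definition absolutely_min_attaining :: "('a::complex_inner \<Rightarrow> 'a) \<Rightarrow> bool"
  where "absolutely_min_attaining T \<longleftrightarrow> bounded_clinear T \<and>
    (\<forall>M. csubspace M \<and> closed M \<and> M \<noteq> {0} \<longrightarrow> min_attaining_on M T)"

end

theory Submission
  imports Defs
begin

text \<open>
  Roughly, the theorem says that \<open>T\<close> is a multiple \<open>\<beta>\<close> of the identity plus a compact operator whose
  positive part has finite rank: the eigenvalues of \<open>T\<close> may accumulate at \<open>\<beta>\<close> from below, but not from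
  above, and nowhere else. The proof avoids the spectral theorem
  and compact operators. It works with estimates for \<open>norm (T x)\<close> that hold \<^emph>\<open>outside finitely many
  directions\<close>, that is, for all \<open>x\<close> orthogonal to some finite set \<open>S\<close>.

  The bridge to the spectrum is a form of Weyl's criterion: \<open>l\<close> is in the essential spectrum iff there are
  unit vectors with \<open>T x - l *\<^sub>R x\<close> arbitrarily small outside any finitely many directions
  (\<open>essential_spectrum_eq_weyl\<close>). One half rests on the fact that \<open>T - l\<close> is bounded below on the
  complement of the eigenspace of an isolated point \<open>l\<close> of the spectrum
  (\<open>isolated_bounded_below_off_eigenspace\<close>), the other half on a compactness argument that shows infima of
  \<open>norm (A x)\<close> to be attained (\<open>infimum_attained\<close>). A minimax argument yields the least such value \<open>\<gamma>\<close>,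
  and for every \<open>c < \<gamma>\<close> the estimate \<open>norm (T x) \<ge> c * norm x\<close> outside finitely many directions
  (\<open>least_weyl_value\<close>).

  If \<open>T\<close> is absolutely minimum attaining, then for each \<open>m \<ge> 0\<close> there are a finite set \<open>S\<close> and \<open>e > 0\<close>
  such that no unit vector orthogonal to \<open>S\<close> has \<open>m < norm (T x) < m + e\<close>. Otherwise an orthonormal
  sequence with orthogonal images and with \<open>norm (T x)\<close> tending to \<open>m\<close> strictly from above would span a subspace
  on which the minimum is not attained (\<open>absolutely_min_attaining_gap\<close>). The values
  of \<open>norm (T x)\<close> on the unit sphere of a subspace form an interval. Two different points of the
  essential spectrum would make this interval cross such a gap, so \<open>\<gamma>\<close> is the only point. The gap above
  \<open>\<gamma>\<close> itself gives \<open>norm (T x) \<le> \<gamma> * norm x\<close> outside finitely many directions, which leaves room for only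
  finitely many eigenvalues above \<open>\<gamma>\<close>.

  Conversely, if \<open>\<gamma>\<close> is the only point of the essential spectrum and only finitely many eigenvalues exceed it,
  then everything above \<open>\<gamma>\<close> is carried by finitely many finite-dimensional eigenspaces, and
  \<open>norm (T x) \<le> \<gamma> * norm x\<close> holds outside them. So on an infinite-dimensional closed subspace
  the infimum \<open>m\<close> of \<open>norm (T x)\<close> is at most \<open>\<gamma>\<close>. If \<open>m = \<gamma>\<close>, any of its unit vectors outside those directions attains it,
  and if \<open>m < \<gamma>\<close>, the lower estimates between \<open>m\<close> and \<open>\<gamma>\<close> give attainment by compactness.
\<close>

section \<open>Orthogonal complements and the projection theorem\<close>

text \<open>
  Orthogonality is taken in the real inner product, although the operators act on complex spaces.
  For a complex subspace, or any set closed under multiplication by \<open>\<i>\<close>, this is the complex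
  orthogonal complement, and a finite set can always be enlarged to one closed in this sense up to
  sign. So ``outside finitely many directions'' means the same in both settings, and the geometric
  lemmas hold in arbitrary real Hilbert spaces.
\<close>

definition perp :: "'a::real_inner set \<Rightarrow> 'a set"
  where "perp S = {x. \<forall>s\<in>S. inner x s = 0}"

lemma perpI: "(\<And>s. s \<in> S \<Longrightarrow> inner x s = 0) \<Longrightarrow> x \<in> perp S"
  and perpD: "x \<in> perp S \<Longrightarrow> s \<in> S \<Longrightarrow> inner x s = 0"
  by (auto simp: perp_def)

lemma subspace_perp: "subspace (perp S)"
  by (auto simp: perp_def subspace_def inner_add_left)

lemma perp_antimono: "S \<subseteq> S' \<Longrightarrow> perp S' \<subseteq> perp S"
  by (auto simp: perp_def)

lemma closed_perp: "closed (perp S)"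
proof -
  have "perp S = (\<Inter>s\<in>S. {x. inner x s = 0})" by (auto simp: perp_def)
  then show ?thesis by (auto intro!: closed_INT closed_Collect_eq continuous_intros)
qed

lemma perp_span: "perp (span S) = perp S"
proof
  show "perp (span S) \<subseteq> perp S"
    by (rule perp_antimono) (rule span_superset)
  show "perp S \<subseteq> perp (span S)"
  proof
    fix x assume x: "x \<in> perp S"
    have "inner x y = 0" if "y \<in> span S" for y
      using that
      by (induction rule: span_induct)
        (auto simp: subspace_def inner_add_right intro: perpD[OF x])
    then show "x \<in> perp (span S)" by (rule perpI)
  qed
qed

lemma perp_closure_self:
  assumes "x \<in> perp G" "x \<in> closure G" shows "x = 0"
proof -
  have "G \<subseteq> {y. inner x y = 0}" using assms(1) by (auto simp: perp_def)
  moreover have "closed {y. inner x y = 0}" by (intro closed_Collect_eq continuous_intros)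
  ultimately have "x \<in> {y. inner x y = 0}" using assms(2) closure_minimal by blast
  then show "x = 0" by simp
qed

lemma normalize_in_subspace:
  assumes "subspace V" "x \<in> V" "x \<noteq> 0"
  shows "(1 / norm x) *\<^sub>R x \<in> V" "norm ((1 / norm x) *\<^sub>R x) = 1"
  using assms by (auto intro: subspace_scale)

lemma norm_ge_from_unit_sphere:
  assumes f: "linear f" and V: "subspace V"
    and ge: "\<And>u. u \<in> V \<Longrightarrow> norm u = 1 \<Longrightarrow> c \<le> norm (f u)" and x: "x \<in> V"
  shows "c * norm x \<le> norm (f x)"
proof (cases "x = 0")
  case False
  have "c \<le> norm (f ((1 / norm x) *\<^sub>R x))"
    by (intro ge normalize_in_subspace[OF V x False])
  then show ?thesis using False by (simp add: linear_scale[OF f] field_simps)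
qed simp

text \<open>
  This turns parallelogram estimates into convergence of minimizing sequences: each defect from the
  minimum bounds the distance additively.
\<close>

lemma Cauchy_if_dist_le_null:
  fixes x :: "nat \<Rightarrow> 'a::metric_space"
  assumes "w \<longlonglongrightarrow> (0::real)" "\<And>n k. dist (x n) (x k) \<le> w n + w k"
  shows "Cauchy x"
proof (rule metric_CauchyI)
  fix e :: real assume "e > 0"
  then have "\<forall>\<^sub>F n in sequentially. w n < e / 2"
    using order_tendstoD(2)[OF assms(1), of "e/2"] by simp
  then obtain N where "\<And>n. n \<ge> N \<Longrightarrow> w n < e / 2" by (auto simp: eventually_sequentially)
  then have "dist (x m) (x n) < e" if "m \<ge> N" "n \<ge> N" for m n
    using assms(2)[of m n] that by (smt (verit) field_sum_of_halves)
  then show "\<exists>M. \<forall>m\<ge>M. \<forall>n\<ge>M. dist (x m) (x n) < e" by blast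
qed

text \<open>
  First-order condition at a minimum: a quadratic polynomial in \<open>t\<close> that vanishes at \<open>0\<close> and is
  nonnegative everywhere has no linear term.
\<close>

lemma linear_coeff_zero:
  fixes b c :: real
  assumes "\<And>t. 0 \<le> 2 * t * b + t\<^sup>2 * c"
  shows "b = 0"
proof (rule ccontr)
  assume b: "b \<noteq> 0"
  define k where "k = \<bar>c\<bar> + 1"
  have k: "k > 0" "c < k" "c * b\<^sup>2 < k * b\<^sup>2" using b by (auto simp: k_def)
  have "0 \<le> 2 * (- b / k) * b + (- b / k)\<^sup>2 * c" by (rule assms)
  then have "0 \<le> (2 * (- b / k) * b + (- b / k)\<^sup>2 * c) * k\<^sup>2" by simp
  also have "\<dots> = - 2 * b\<^sup>2 * k + b\<^sup>2 * c"
    using k(1) by (simp add: field_simps power2_eq_square)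
  also have "\<dots> < - b\<^sup>2 * k" using k by (simp add: algebra_simps)
  also have "\<dots> \<le> 0" using k by simp
  finally show False by simp
qed

lemma norm_diff_scaleR_squared:
  fixes u z :: "'a::real_inner"
  shows "(norm (u - t *\<^sub>R z))\<^sup>2 = (norm u)\<^sup>2 - 2 * t * inner u z + t\<^sup>2 * (norm z)\<^sup>2"
  unfolding power2_norm_eq_inner
  by (simp add: inner_diff_left inner_diff_right inner_commute algebra_simps power2_eq_square)

text \<open>
  The projection theorem. Two points of \<open>R\<close> that almost realise the distance from \<open>x\<close> have a midpoint
  in \<open>R\<close>, which is no nearer, so the parallelogram law forces them to be close to each other. Hence
  minimizing sequences converge, and the first-order condition at the nearest point is
  orthogonality.
\<close>

lemma projection_exists:
  fixes R :: "'a::{real_inner,complete_space} set"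
  assumes "subspace R" "closed R"
  obtains r where "r \<in> R" "x - r \<in> perp R"
proof -
  define D where "D = {norm (x - y) |y. y \<in> R}"
  define d where "d = Inf D"
  have D0: "D \<noteq> {}" using subspace_0[OF assms(1)] by (auto simp: D_def)
  have bdd: "bdd_below D" by (auto simp: D_def intro: bdd_belowI[of _ 0])
  have dle: "d \<le> norm (x - y)" if "y \<in> R" for y
    unfolding d_def using that bdd by (auto simp: D_def intro: cInf_lower)
  have d0: "d \<ge> 0" unfolding d_def using D0 by (rule cInf_greatest) (auto simp: D_def)
  have "\<exists>y\<in>R. norm (x - y) < d + 1 / real (Suc n)" for n
  proof -
    have "Inf D < d + 1 / real (Suc n)" by (simp add: d_def)
    then show ?thesis using cInf_less_iff[OF D0 bdd] by (auto simp: D_def)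
  qed
  then obtain y where y: "\<And>n. y n \<in> R" "\<And>n. norm (x - y n) < d + 1 / real (Suc n)" by metis
  have lim: "(\<lambda>n. norm (x - y n)) \<longlonglongrightarrow> d"
  proof (rule tendsto_sandwich[of "\<lambda>_. d" _ _ "\<lambda>n. d + 1 / real (Suc n)"])
    show "(\<lambda>n. d + 1 / real (Suc n)) \<longlonglongrightarrow> d"
      using tendsto_add[OF tendsto_const[of d] LIMSEQ_inverse_real_of_nat] by (simp add: field_simps)
  qed (use dle y in \<open>auto intro!: always_eventually less_imp_le simp del: of_nat_Suc\<close>)
  define w where "w n = sqrt (2 * ((norm (x - y n))\<^sup>2 - d\<^sup>2))" for n
  have "w \<longlonglongrightarrow> sqrt (2 * (d\<^sup>2 - d\<^sup>2))" unfolding w_def by (intro tendsto_intros lim)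
  then have w0: "w \<longlonglongrightarrow> 0" by simp
  have "dist (y n) (y k) \<le> w n + w k" for n k
  proof -
    define u where "u = (1/2) *\<^sub>R (y n + y k)"
    have u: "u \<in> R" using y assms(1) by (auto simp: u_def intro: subspace_scale subspace_add)
    have "(norm (y n - y k))\<^sup>2 =
        2 * (norm (x - y n))\<^sup>2 + 2 * (norm (x - y k))\<^sup>2 - 4 * (norm (x - u))\<^sup>2"
      by (simp add: u_def power2_norm_eq_inner inner_diff_left inner_diff_right inner_add_left
        inner_add_right inner_commute algebra_simps)
    also have "\<dots> \<le> 2 * ((norm (x - y n))\<^sup>2 - d\<^sup>2) + 2 * ((norm (x - y k))\<^sup>2 - d\<^sup>2)"
      using power_mono[OF dle[OF u] d0, of 2] by simp
    finally have "norm (y n - y k)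
        \<le> sqrt (2 * ((norm (x - y n))\<^sup>2 - d\<^sup>2) + 2 * ((norm (x - y k))\<^sup>2 - d\<^sup>2))"
      by (simp add: real_le_rsqrt)
    also have "\<dots> \<le> w n + w k" unfolding w_def
      by (rule sqrt_add_le_add_sqrt) (use power_mono[OF dle[OF y(1)] d0, of 2] in auto)
    finally show ?thesis by (simp add: dist_norm)
  qed
  with w0 have "Cauchy y" by (rule Cauchy_if_dist_le_null)
  then obtain r where r: "y \<longlonglongrightarrow> r" using Cauchy_convergent convergent_def by blast
  have rR: "r \<in> R" using closed_sequentially[OF assms(2) _ r] y by blast
  have "(\<lambda>n. norm (x - y n)) \<longlonglongrightarrow> norm (x - r)" by (intro tendsto_intros r)
  then have nr: "norm (x - r) = d" using lim LIMSEQ_unique by blast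
  have "inner (x - r) z = 0" if z: "z \<in> R" for z
  proof -
    have "0 \<le> 2 * t * (- inner (x - r) z) + t\<^sup>2 * (norm z)\<^sup>2" for t
    proof -
      have "d \<le> norm (x - (r + t *\<^sub>R z))"
        by (intro dle subspace_add subspace_scale assms rR z)
      then have "(norm (x - r))\<^sup>2 \<le> (norm ((x - r) - t *\<^sub>R z))\<^sup>2"
        using d0 nr by (simp add: diff_diff_eq)
      then show ?thesis by (simp add: norm_diff_scaleR_squared)
    qed
    then show ?thesis using linear_coeff_zero by fastforce
  qed
  then show thesis using that rR by (auto simp: perp_def)
qed

section \<open>Attainment of infima and nonnegative forms\<close>

lemma simultaneous_convergent_subsequence:
  fixes f :: "'b \<Rightarrow> nat \<Rightarrow> real"
  assumes "finite C" "\<And>b. b \<in> C \<Longrightarrow> bounded (range (f b))"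
  obtains r l where "strict_mono (r :: nat \<Rightarrow> nat)" "\<And>b. b \<in> C \<Longrightarrow> (\<lambda>n. f b (r n)) \<longlonglongrightarrow> l b"
proof -
  have "\<exists>r l. strict_mono (r :: nat \<Rightarrow> nat) \<and> (\<forall>b\<in>C. (\<lambda>n. f b (r n)) \<longlonglongrightarrow> l b)"
    using assms
  proof (induction rule: finite_induct)
    case empty
    show ?case by (auto intro!: exI[of _ id] simp: strict_mono_def)
  next
    case (insert a C)
    then obtain r l where r: "strict_mono (r :: nat \<Rightarrow> nat)"
      and l: "\<And>b. b \<in> C \<Longrightarrow> (\<lambda>n. f b (r n)) \<longlonglongrightarrow> l b" by auto
    have "bounded (range (\<lambda>n. f a (r n)))"
      by (rule bounded_subset[OF insert.prems[of a]]) auto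
    then obtain l0 s where s: "strict_mono (s :: nat \<Rightarrow> nat)"
      "((\<lambda>n. f a (r n)) \<circ> s) \<longlonglongrightarrow> l0" using bounded_imp_convergent_subsequence by blast
    have "(\<lambda>n. f b ((r \<circ> s) n)) \<longlonglongrightarrow> (l(a := l0)) b" if "b \<in> insert a C" for b
      using that s LIMSEQ_subseq_LIMSEQ[OF l s(1)] by (auto simp: o_def)
    moreover have "strict_mono (r \<circ> s)" using r s(1) by (rule strict_mono_o)
    ultimately show ?case by blast
  qed
  then show thesis using that by blast
qed

text \<open>
  The component of \<open>y\<close> along finitely many directions is controlled by finitely many numbers. Unlike
  points of the Hilbert space, these numbers have convergent subsequences.
\<close>

lemma orthogonal_split:
  fixes C :: "'a::real_inner set"
  assumes "finite C" "pairwise orthogonal C"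
  obtains K where "K \<ge> 0"
    "\<And>y. \<exists>g. g \<in> span C \<and> y - g \<in> perp C \<and> norm g \<le> K * (\<Sum>b\<in>C. \<bar>inner y b\<bar>)"
proof
  define K where "K = (\<Sum>b\<in>C. norm b / inner b b)"
  show "K \<ge> 0" by (auto simp: K_def intro!: sum_nonneg)
  fix y
  define g where "g = (\<Sum>b\<in>C. (inner y b / inner b b) *\<^sub>R b)"
  have "g \<in> span C" unfolding g_def by (intro span_sum span_scale span_base)
  moreover have "inner (y - g) s = 0" if s: "s \<in> C" for s
  proof -
    have "inner g s = (\<Sum>b\<in>C. if b = s then inner y s else 0)"
      unfolding g_def inner_sum_left
    proof (rule sum.cong)
      fix b assume "b \<in> C"
      then have "b \<noteq> s \<Longrightarrow> inner b s = 0"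
        using assms(2) s by (auto simp: pairwise_def orthogonal_def)
      then show "inner ((inner y b / inner b b) *\<^sub>R b) s = (if b = s then inner y s else 0)"
        by (cases "s = 0") auto
    qed simp
    also have "\<dots> = inner y s" using assms(1) s by simp
    finally show ?thesis by (simp add: inner_diff_left)
  qed
  then have "y - g \<in> perp C" by (rule perpI)
  moreover have "norm g \<le> K * (\<Sum>b\<in>C. \<bar>inner y b\<bar>)"
  proof -
    have "norm g \<le> (\<Sum>b\<in>C. norm ((inner y b / inner b b) *\<^sub>R b))"
      unfolding g_def by (rule norm_sum)
    also have "\<dots> = (\<Sum>b\<in>C. (norm b / inner b b) * \<bar>inner y b\<bar>)"
      by (intro sum.cong) (auto simp: field_simps)
    also have "\<dots> \<le> (\<Sum>b\<in>C. K * \<bar>inner y b\<bar>)"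
    proof (rule sum_mono)
      fix b assume "b \<in> C"
      then have "norm b / inner b b \<le> K" unfolding K_def
        using assms(1) by (intro member_le_sum) auto
      then show "(norm b / inner b b) * \<bar>inner y b\<bar> \<le> K * \<bar>inner y b\<bar>"
        by (rule mult_right_mono) simp
    qed
    finally show ?thesis by (simp add: sum_distrib_left)
  qed
  ultimately show "\<exists>g. g \<in> span C \<and> y - g \<in> perp C \<and> norm g \<le> K * (\<Sum>b\<in>C. \<bar>inner y b\<bar>)"
    by blast
qed

text \<open>
  A form bound gives a norm bound: evaluating the nonnegative form of \<open>D\<close> at \<open>x - t *\<^sub>R D x\<close> and
  taking \<open>t = 1/K\<close> yields the claim. So a vector at which a nonnegative form is small is almost
  annihilated by the corresponding operator. The condition on \<open>D x\<close> stands in for invariance of \<open>V\<close>: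
  the spaces \<open>perp S\<close> are rarely invariant, but orthogonality of \<open>x\<close> to the finite set \<open>D ` S\<close> suffices
  for \<open>D x \<in> perp S\<close>.
\<close>

lemma symmetric_form_bound:
  fixes D :: "'a::real_inner \<Rightarrow> 'a"
  assumes D: "linear D" "\<And>x y. inner (D x) y = inner x (D y)"
    and V: "subspace V" "x \<in> V" "D x \<in> V"
    and nonneg: "\<And>y. y \<in> V \<Longrightarrow> 0 \<le> inner (D y) y"
    and K: "0 \<le> K" "\<And>y. y \<in> V \<Longrightarrow> inner (D y) y \<le> K * (norm y)\<^sup>2"
  shows "(norm (D x))\<^sup>2 \<le> K * inner (D x) x"
proof -
  define N where "N = (norm (D x))\<^sup>2"
  have *: "2 * t * N \<le> inner (D x) x + t\<^sup>2 * (K * N)" for t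
  proof -
    have "0 \<le> inner (D (x - t *\<^sub>R D x)) (x - t *\<^sub>R D x)"
      by (intro nonneg subspace_diff subspace_scale V)
    also have "\<dots> = inner (D x) x - 2 * t * N + t\<^sup>2 * inner (D (D x)) (D x)"
      using D(2)[of "D x" x] unfolding N_def power2_norm_eq_inner
      by (simp add: linear_diff[OF D(1)] linear_scale[OF D(1)] inner_diff_left inner_diff_right inner_commute algebra_simps power2_eq_square)
    also have "\<dots> \<le> inner (D x) x - 2 * t * N + t\<^sup>2 * (K * N)"
      using K(2)[OF V(3)] by (simp add: N_def mult_left_mono)
    finally show ?thesis by simp
  qed
  show ?thesis
  proof (cases "K = 0")
    case True
    then have "inner (D x) x = 0" using nonneg[OF V(2)] K(2)[OF V(2)] by simp
    \<comment> \<open>with \<open>K = 0\<close> any positive \<open>t\<close> works\<close>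
    then show ?thesis using *[of 1] True by (simp add: N_def)
  next
    case False
    then have "K > 0" using K(1) by simp
    then have "K * (2 * (1/K) * N) \<le> K * (inner (D x) x + (1/K)\<^sup>2 * (K * N))"
      using *[of "1/K"] by (intro mult_left_mono) auto
    with \<open>K > 0\<close> show ?thesis by (simp add: N_def field_simps power2_eq_square)
  qed
qed

text \<open>
  A compactness argument without weak topologies. The function \<open>q x = (norm (A x))\<^sup>2 - m\<^sup>2 * (norm x)\<^sup>2\<close> is
  nonnegative on \<open>M\<close> and obeys the parallelogram law, so \<open>q\<close> is small at differences of members of a
  minimizing sequence. A subsequence has convergent components along \<open>S\<close>, so such
  a difference is nearly orthogonal to \<open>S\<close>, where \<open>norm (A y) \<ge> c * norm y\<close> with \<open>c > m\<close>. Both can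
  only hold if the difference is small, and the subsequence is Cauchy.

  The ambient space \<open>M'\<close> serves two purposes: it is the whole space in the infinite-dimensional
  applications, and \<open>M\<close> itself, spanned by \<open>S\<close>, when \<open>M\<close> has finite dimension.
\<close>

lemma infimum_attained:
  fixes A :: "'a::{real_inner,complete_space} \<Rightarrow> 'b::real_inner"
  assumes A: "bounded_linear A"
    and M: "subspace M" "closed M" "M \<noteq> {0}"
    and M': "subspace M'" "M \<subseteq> M'"
    and S: "finite S" "S \<subseteq> M'"
    and c: "m < c" "\<And>y. y \<in> M' \<Longrightarrow> y \<in> perp S \<Longrightarrow> c * norm y \<le> norm (A y)"
    and m: "m = Inf {norm (A x) |x. x \<in> M \<and> norm x = 1}"
  shows "\<exists>x\<in>M. norm x = 1 \<and> norm (A x) = m"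
proof -
  interpret A: bounded_linear A by (rule A)
  define E where "E = {norm (A x) |x. x \<in> M \<and> norm x = 1}"
  obtain x0 where x0: "x0 \<in> M" "x0 \<noteq> 0" using M subspace_0 by blast
  have E0: "E \<noteq> {}" using normalize_in_subspace[OF M(1) x0] by (auto simp: E_def)
  have bdd: "bdd_below E" by (auto simp: E_def intro: bdd_belowI[of _ 0])
  have m0: "m \<ge> 0" unfolding m using E0 by (intro cInf_greatest) (auto simp: E_def)
  have mle1: "m \<le> norm (A x)" if "x \<in> M" "norm x = 1" for x
    unfolding m E_def[symmetric] using that by (auto simp: E_def intro!: cInf_lower bdd[unfolded E_def])
  have mle: "m * norm x \<le> norm (A x)" if "x \<in> M" for x
    using A.linear_axioms M(1) mle1 that by (rule norm_ge_from_unit_sphere)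
  have "\<exists>x\<in>M. norm x = 1 \<and> norm (A x) < m + 1 / real (Suc n)" for n
  proof -
    have "Inf E < m + 1 / real (Suc n)" by (simp add: m E_def)
    then show ?thesis using cInf_less_iff[OF E0 bdd] by (auto simp: E_def)
  qed
  then obtain z where z: "\<And>n. z n \<in> M" "\<And>n. norm (z n) = 1"
    "\<And>n. norm (A (z n)) < m + 1 / real (Suc n)" by metis
  have limz: "(\<lambda>n. norm (A (z n))) \<longlonglongrightarrow> m"
  proof (rule tendsto_sandwich[of "\<lambda>_. m" _ _ "\<lambda>n. m + 1 / real (Suc n)"])
    show "(\<lambda>n. m + 1 / real (Suc n)) \<longlonglongrightarrow> m"
      using tendsto_add[OF tendsto_const[of m] LIMSEQ_inverse_real_of_nat] by (simp add: field_simps)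
  qed (use mle1 z in \<open>auto intro!: always_eventually less_imp_le simp del: of_nat_Suc\<close>)
  obtain C where C: "finite C" "span C = span S" "pairwise orthogonal C"
    using basis_orthogonal[OF S(1)] by auto
  obtain K where K: "K \<ge> 0"
    "\<And>y. \<exists>g. g \<in> span C \<and> y - g \<in> perp C \<and> norm g \<le> K * (\<Sum>b\<in>C. \<bar>inner y b\<bar>)"
    using orthogonal_split[OF C(1,3)] by blast
  have "bounded (range (\<lambda>n. inner (z n) b))" for b
    unfolding bounded_iff using z(2) Cauchy_Schwarz_ineq2[of "z _" b]
    by (intro exI[of _ "norm b"]) auto
  then obtain r l where r: "strict_mono (r :: nat \<Rightarrow> nat)"
    "\<And>b. b \<in> C \<Longrightarrow> (\<lambda>n. inner (z (r n)) b) \<longlonglongrightarrow> l b"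
    using simultaneous_convergent_subsequence[OF C(1), of "\<lambda>b n. inner (z n) b"] by blast
  define x where "x n = z (r n)" for n
  have x: "\<And>n. x n \<in> M" "\<And>n. norm (x n) = 1" using z by (auto simp: x_def)
  have limx: "(\<lambda>n. norm (A (x n))) \<longlonglongrightarrow> m"
    using LIMSEQ_subseq_LIMSEQ[OF limz r(1)] by (simp add: x_def o_def)
  define L where "L = onorm A + c"
  have L0: "L \<ge> 0" using onorm_pos_le[OF A] m0 c(1) by (simp add: L_def)
  define q where "q n = (norm (A (x n)))\<^sup>2 - m\<^sup>2" for n
  have q0: "q n \<ge> 0" for n using power_mono[OF mle1[OF x(1)[of n] x(2)[of n]] m0, of 2] by (simp add: q_def)
  define s where "s n = (\<Sum>b\<in>C. \<bar>inner (x n) b - l b\<bar>)" for n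
  \<comment> \<open>\<open>q n\<close> measures the defect from the infimum, \<open>s n\<close> the distance of the \<open>C\<close>-components from their limits\<close>
  define w where "w n = (sqrt (2 * q n) + L * (K * s n)) / (c - m)" for n
  have wc: "w n * (c - m) = sqrt (2 * q n) + L * (K * s n)" for n
    using c(1) by (simp add: w_def)
  have "w \<longlonglongrightarrow> (sqrt (2 * (m\<^sup>2 - m\<^sup>2)) + L * (K * (\<Sum>b\<in>C. \<bar>l b - l b\<bar>))) / (c - m)"
    unfolding w_def q_def s_def x_def
    by (intro tendsto_intros r limx[unfolded x_def]) (use c in auto)
  then have w0: "w \<longlonglongrightarrow> 0" by simp
  have "dist (x n) (x k) \<le> w n + w k" for n k
  proof -
    define y where "y = x n - x k"
    have "(m * norm (x n + x k))\<^sup>2 \<le> (norm (A (x n + x k)))\<^sup>2"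
      by (intro power_mono mle subspace_add M x mult_nonneg_nonneg m0) auto
    moreover have "(norm (x n + x k))\<^sup>2 + (norm y)\<^sup>2 = 2 * (norm (x n))\<^sup>2 + 2 * (norm (x k))\<^sup>2"
      unfolding y_def power2_norm_eq_inner
      by (simp add: algebra_simps inner_diff_left inner_diff_right inner_add_left inner_add_right)
    then have "(norm (x n + x k))\<^sup>2 = 4 - (norm y)\<^sup>2" by (simp add: x)
    moreover have "(norm (A (x n + x k)))\<^sup>2 + (norm (A y))\<^sup>2
        = 2 * (norm (A (x n)))\<^sup>2 + 2 * (norm (A (x k)))\<^sup>2"
      unfolding y_def power2_norm_eq_inner A.add A.diff
      by (simp add: algebra_simps inner_diff_left inner_diff_right inner_add_left inner_add_right)
    ultimately have "m\<^sup>2 * (4 - (norm y)\<^sup>2) + (norm (A y))\<^sup>2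
        \<le> 2 * (norm (A (x n)))\<^sup>2 + 2 * (norm (A (x k)))\<^sup>2"
      by (simp add: power_mult_distrib)
    then have "(norm (A y))\<^sup>2 \<le> (m * norm y)\<^sup>2 + (2 * q n + 2 * q k)"
      by (simp add: q_def algebra_simps power_mult_distrib)
    then have "norm (A y) \<le> sqrt ((m * norm y)\<^sup>2 + (2 * q n + 2 * q k))"
      by (rule real_le_rsqrt)
    also have "\<dots> \<le> sqrt ((m * norm y)\<^sup>2) + sqrt (2 * q n + 2 * q k)"
      by (rule sqrt_add_le_add_sqrt) (use q0 in auto)
    also have "\<dots> \<le> m * norm y + (sqrt (2 * q n) + sqrt (2 * q k))"
      using sqrt_add_le_add_sqrt[of "2 * q n" "2 * q k"] q0 m0 by simp
    finally have Ay: "norm (A y) \<le> m * norm y + (sqrt (2 * q n) + sqrt (2 * q k))" .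
    obtain g where g: "g \<in> span C" "y - g \<in> perp C"
      "norm g \<le> K * (\<Sum>b\<in>C. \<bar>inner y b\<bar>)" using K(2) by blast
    have "(\<Sum>b\<in>C. \<bar>inner y b\<bar>) \<le> (\<Sum>b\<in>C. \<bar>inner (x n) b - l b\<bar> + \<bar>inner (x k) b - l b\<bar>)"
      unfolding y_def by (intro sum_mono) (simp add: inner_diff_left)
    also have "\<dots> = s n + s k" by (simp add: s_def sum.distrib)
    finally have gs: "norm g \<le> K * (s n + s k)"
      using g(3) K(1) by (meson mult_left_mono order_trans)
    have yM: "y \<in> M'" using x M'(2) by (auto simp: y_def intro!: subspace_diff[OF M'(1)])
    have "g \<in> M'" using g(1) C(2) span_minimal[OF S(2) M'(1)] by auto
    then have "y - g \<in> M'" using yM by (intro subspace_diff[OF M'(1)])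
    moreover have "y - g \<in> perp S" using g(2) perp_span C(2) by metis
    ultimately have "c * norm (y - g) \<le> norm (A (y - g))" by (rule c(2))
    also have "\<dots> \<le> norm (A y) + norm (A g)" by (simp add: A.diff norm_triangle_ineq4)
    also have "\<dots> \<le> norm (A y) + onorm A * norm g" using onorm[OF A] by simp
    finally have 1: "c * norm (y - g) \<le> norm (A y) + onorm A * norm g" .
    have "norm y \<le> norm (y - g) + norm g" by norm
    then have "c * norm y \<le> c * norm (y - g) + c * norm g"
      using c(1) m0 by (metis distrib_left less_eq_real_def mult_left_mono order_le_less_trans)
    with 1 Ay have "(c - m) * norm y \<le> sqrt (2 * q n) + sqrt (2 * q k) + L * norm g"
      by (simp add: L_def algebra_simps)
    also have "\<dots> \<le> sqrt (2 * q n) + sqrt (2 * q k) + L * (K * (s n + s k))"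
      using gs L0 by (simp add: mult_left_mono)
    also have "\<dots> = (w n + w k) * (c - m)"
      unfolding distrib_right wc by (simp add: algebra_simps)
    finally show ?thesis using c(1) by (simp add: y_def dist_norm mult.commute)
  qed
  with w0 have "Cauchy x" by (rule Cauchy_if_dist_le_null)
  then obtain u where u: "x \<longlonglongrightarrow> u" using Cauchy_convergent convergent_def by blast
  have "u \<in> M" using closed_sequentially[OF M(2) _ u] x by blast
  moreover have "norm u = 1"
    using tendsto_norm[OF u] x(2) by (simp add: LIMSEQ_const_iff)
  moreover have "(\<lambda>n. norm (A (x n))) \<longlonglongrightarrow> norm (A u)" by (intro tendsto_intros A.tendsto u)
  then have "norm (A u) = m" using limx LIMSEQ_unique by blast
  ultimately show ?thesis by blast
qed

section \<open>Complex inner product spaces\<close>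

lemma cinner_add_right: "cinner x (y + z) = cinner x y + cinner x z"
  for x :: "'a::complex_inner"
  by (metis cinner_add_left cinner_commute complex_cnj_add)

lemma cinner_scaleC_right: "cinner x (c *\<^sub>C y) = cnj c * cinner x y"
  for x :: "'a::complex_inner"
  by (metis cinner_scaleC_left cinner_commute complex_cnj_mult)

lemma cinner_zero_left [simp]: "cinner 0 x = 0"
  for x :: "'a::complex_inner"
  using cinner_add_left[of 0 0 x] by simp

lemma cinner_zero_right [simp]: "cinner x 0 = 0"
  for x :: "'a::complex_inner"
  using cinner_add_right[of x 0 0] by simp

lemma cinner_diff_left: "cinner (x - y) z = cinner x z - cinner y z"
  for x :: "'a::complex_inner"
  using cinner_add_left[of "x - y" y z] by simp

lemma cinner_diff_right: "cinner x (y - z) = cinner x y - cinner x z"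
  for x :: "'a::complex_inner"
  using cinner_add_right[of x "y - z" z] by simp

lemma cinner_sum_left: "cinner (sum f F) y = (\<Sum>a\<in>F. cinner (f a) y)"
  for y :: "'a::complex_inner"
  by (induction F rule: infinite_finite_induct) (auto simp: cinner_add_left)

lemma cinner_self: "cinner x x = complex_of_real ((norm x)\<^sup>2)"
  for x :: "'a::complex_inner"
proof (rule complex_eqI)
  show "Re (cinner x x) = Re (complex_of_real ((norm x)\<^sup>2))"
    by (simp add: power2_norm_eq_inner inner_eq_Re_cinner)
  show "Im (cinner x x) = Im (complex_of_real ((norm x)\<^sup>2))"
    using arg_cong[OF cinner_commute[of x x], of Im] by simp
qed

text \<open>
  The complex inner product is recovered from the real one, so orthogonality to \<open>y\<close> and to
  \<open>\<i> *\<^sub>C y\<close> in the real sense is complex orthogonality to \<open>y\<close>.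
\<close>

lemma cinner_eq_inner: "cinner x y = Complex (inner x y) (inner x (\<i> *\<^sub>C y))"
  for x :: "'a::complex_inner"
  by (simp add: complex_eq_iff inner_eq_Re_cinner cinner_scaleC_right)

lemma inner_scaleC_left: "inner (c *\<^sub>C x) y = inner x (cnj c *\<^sub>C y)"
  for x :: "'a::complex_inner"
  by (simp add: inner_eq_Re_cinner cinner_scaleC_right cinner_scaleC_left)

lemma norm_scaleC: "norm (c *\<^sub>C x) = cmod c * norm x"
  for x :: "'a::complex_inner"
proof -
  have "complex_of_real ((norm (c *\<^sub>C x))\<^sup>2) = complex_of_real ((cmod c * norm x)\<^sup>2)"
    unfolding cinner_self[symmetric] cinner_scaleC_left cinner_scaleC_right
    by (simp add: cinner_self power_mult_distrib complex_norm_square mult.assoc[symmetric] del: of_real_power)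
  then show ?thesis by (simp add: power2_eq_iff_nonneg del: of_real_power)
qed

lemma bounded_linear_scaleC: "bounded_linear (\<lambda>x::'a::complex_inner. c *\<^sub>C x)"
  by (rule bounded_linear_intro[of _ "cmod c"])
    (auto simp: scaleC_add_right scaleR_scaleC scaleC_scaleC norm_scaleC mult.commute)

lemma continuous_on_cinner_left [continuous_intros]:
  fixes f :: "'b::topological_space \<Rightarrow> 'a::complex_inner"
  assumes "continuous_on S f"
  shows "continuous_on S (\<lambda>x. cinner (f x) y)"
  unfolding cinner_eq_inner Complex_eq by (intro continuous_intros assms)

lemma Pythagoras_cinner:
  fixes x y :: "'a::complex_inner"
  assumes "cinner x y = 0"
  shows "(norm (x + y))\<^sup>2 = (norm x)\<^sup>2 + (norm y)\<^sup>2"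
  using assms inner_eq_Re_cinner[of x y] inner_commute[of x y]
  by (simp add: power2_norm_eq_inner inner_add_left inner_add_right)

lemma csubspace_imp_subspace: "csubspace M \<Longrightarrow> subspace M"
  unfolding complex_vector.subspace_def subspace_def by (simp add: scaleR_scaleC)

lemma csubspace_closure:
  fixes M :: "'a::complex_inner set"
  assumes "csubspace M" shows "csubspace (closure M)"
proof (rule complex_vector.subspaceI)
  show "0 \<in> closure M"
    using complex_vector.subspace_0[OF assms] closure_subset by blast
  show "x + y \<in> closure M" if xy: "x \<in> closure M" "y \<in> closure M" for x y
  proof -
    obtain f g where "\<And>n. f n \<in> M" "f \<longlonglongrightarrow> x" "\<And>n. g n \<in> M" "g \<longlonglongrightarrow> y"
      using xy by (auto simp: closure_sequential)
    then have "\<forall>n. f n + g n \<in> M" "(\<lambda>n. f n + g n) \<longlonglongrightarrow> x + y"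
      using complex_vector.subspace_add[OF assms] by (auto intro: tendsto_add)
    then show ?thesis unfolding closure_sequential by (intro exI[of _ "\<lambda>n. f n + g n"]) auto
  qed
  show "c *\<^sub>C x \<in> closure M" if "x \<in> closure M" for c x
  proof -
    have "(*\<^sub>C) c ` closure M \<subseteq> closure ((*\<^sub>C) c ` M)"
      by (rule closure_bounded_linear_image_subset[OF bounded_linear_scaleC])
    also have "\<dots> \<subseteq> closure M"
      by (rule closure_mono) (use complex_vector.subspace_scale[OF assms] in auto)
    finally show ?thesis using that by auto
  qed
qed

lemma cspan_eq_span: "cspan B = span (B \<union> (*\<^sub>C) \<i> ` B)"
  for B :: "'a::complex_vector set"
proof
  let ?R = "span (B \<union> (*\<^sub>C) \<i> ` B)"
  have i: "\<i> *\<^sub>C x \<in> ?R" if "x \<in> ?R" for x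
    using that
  proof (induction rule: span_induct_alt)
    case base show ?case by (simp add: complex_vector.scale_zero_right span_zero)
  next
    case (step c x y)
    have "\<i> *\<^sub>C x \<in> ?R"
    proof (cases "x \<in> B")
      case True then show ?thesis by (intro span_base) auto
    next
      case False
      then obtain b where b: "b \<in> B" "x = \<i> *\<^sub>C b" using step by auto
      then have eq: "\<i> *\<^sub>C x = (-1) *\<^sub>R b" by (simp add: scaleC_scaleC scaleR_scaleC)
      show ?thesis unfolding eq using b by (intro span_scale span_base) auto
    qed
    then have "c *\<^sub>R (\<i> *\<^sub>C x) + \<i> *\<^sub>C y \<in> ?R" using step by (intro span_add span_scale)
    then show ?case by (simp add: scaleC_add_right scaleR_scaleC scaleC_scaleC mult.commute)
  qed
  have "csubspace ?R"
  proof (rule complex_vector.subspaceI)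
    fix c x assume x: "x \<in> ?R"
    have "Re c *\<^sub>R x + Im c *\<^sub>R (\<i> *\<^sub>C x) \<in> ?R" by (intro span_add span_scale x i)
    also have "Re c *\<^sub>R x + Im c *\<^sub>R (\<i> *\<^sub>C x) = (complex_of_real (Re c) + \<i> * complex_of_real (Im c)) *\<^sub>C x"
      by (simp only: scaleR_scaleC scaleC_scaleC scaleC_add_left mult.commute)
    finally show "c *\<^sub>C x \<in> ?R" by (simp only: complex_eq[symmetric])
  qed (auto intro: span_zero span_add)
  then show "cspan B \<subseteq> ?R" by (intro complex_vector.span_minimal) (auto intro: span_base)
  show "?R \<subseteq> cspan B"
    by (intro span_minimal csubspace_imp_subspace complex_vector.subspace_span)
      (auto intro: complex_vector.span_base complex_vector.span_scale)
qed

section \<open>Infinite-dimensional subspaces and orthogonal families\<close>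

text \<open>
  If the part of \<open>V\<close> orthogonal to \<open>s\<close> were spanned by a finite set, one more vector would span \<open>V\<close>.
\<close>

lemma infinite_dim_hyperplane:
  fixes V :: "'a::complex_inner set"
  assumes V: "csubspace V" "\<not> cfinite_dim V"
  shows "\<not> cfinite_dim (V \<inter> {x. cinner x s = 0})"
proof
  assume "cfinite_dim (V \<inter> {x. cinner x s = 0})"
  then obtain B where B: "finite B" "cspan B = V \<inter> {x. cinner x s = 0}"
    by (auto simp: cfinite_dim_def)
  show False
  proof (cases "V \<subseteq> {x. cinner x s = 0}")
    case True
    then have "cspan B = V" using B by auto
    then show False using V B by (auto simp: cfinite_dim_def)
  next
    case False
    then obtain v where v: "v \<in> V" "cinner v s \<noteq> 0" by auto
    have "x \<in> cspan (insert v B)" if x: "x \<in> V" for x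
    proof -
      define k where "k = cinner x s / cinner v s"
      have "x - k *\<^sub>C v \<in> V"
        using V(1) x v(1) by (intro complex_vector.subspace_diff complex_vector.subspace_scale)
      moreover have "cinner (x - k *\<^sub>C v) s = 0"
        using v by (simp add: cinner_diff_left cinner_scaleC_left k_def)
      ultimately have "x - k *\<^sub>C v \<in> cspan B" using B by simp
      then show ?thesis by (auto simp: complex_vector.span_insert)
    qed
    moreover have "cspan (insert v B) \<subseteq> V"
      using B v complex_vector.span_superset[of B]
      by (intro complex_vector.span_minimal V) auto
    ultimately have "cspan (insert v B) = V" by blast
    then show False using V B(1) unfolding cfinite_dim_def by blast
  qed
qed

lemma infinite_dim_meets_perp:
  fixes V :: "'a::complex_inner set"
  assumes "csubspace V" "\<not> cfinite_dim V" "finite S"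
  obtains x where "x \<in> V" "norm x = 1" "\<And>s. s \<in> S \<Longrightarrow> cinner x s = 0"
proof -
  have "csubspace (V \<inter> {x. \<forall>s\<in>S. cinner x s = 0}) \<and>
      \<not> cfinite_dim (V \<inter> {x. \<forall>s\<in>S. cinner x s = 0})"
    using assms(3)
  proof (induction S rule: finite_induct)
    case empty
    then show ?case using assms by simp
  next
    case (insert a S)
    let ?U = "V \<inter> {x. \<forall>s\<in>S. cinner x s = 0}"
    have eq: "V \<inter> {x. \<forall>s\<in>insert a S. cinner x s = 0} = ?U \<inter> {x. cinner x a = 0}" by auto
    have "csubspace {x. cinner x a = 0}"
      by (rule complex_vector.subspaceI) (auto simp: cinner_add_left cinner_scaleC_left)
    then show ?case unfolding eq
      using insert.IH infinite_dim_hyperplane[of ?U a] complex_vector.subspace_inter by blast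
  qed
  then have U: "csubspace (V \<inter> {x. \<forall>s\<in>S. cinner x s = 0})"
    "\<not> cfinite_dim (V \<inter> {x. \<forall>s\<in>S. cinner x s = 0})" by auto
  have "V \<inter> {x. \<forall>s\<in>S. cinner x s = 0} \<noteq> {0}"
    using U(2) complex_vector.span_empty finite.emptyI unfolding cfinite_dim_def by metis
  then obtain y where y: "y \<in> V \<inter> {x. \<forall>s\<in>S. cinner x s = 0}" "y \<noteq> 0"
    using complex_vector.subspace_0[OF U(1)] by blast
  from normalize_in_subspace[OF csubspace_imp_subspace[OF U(1)] y] that show thesis by blast
qed

lemma perp_if_cinner_zero: "(\<And>s. s \<in> S \<Longrightarrow> cinner x s = 0) \<Longrightarrow> x \<in> perp S"
  for x :: "'a::complex_inner"
  by (auto simp: perp_def inner_eq_Re_cinner)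

text \<open>
  The source of subspaces on which the minimum is not attained. If both \<open>G\<close> and its image under \<open>T\<close> are
  orthogonal families, then \<open>T\<close> acts on the span of \<open>G\<close> like a diagonal operator with entries
  \<open>norm (T a) / norm a > m\<close>. Strictness has to survive the closure, where infinitely many entries may
  accumulate at \<open>m\<close>: some \<open>g \<in> G\<close> is not orthogonal to \<open>x\<close>, and splitting off this one component
  leaves a remainder for which the weak inequality suffices.
\<close>

lemma norm_gt_on_orthogonal_closed_span:
  fixes T :: "'a::complex_inner \<Rightarrow> 'a"
  assumes T: "bounded_clinear T"
    and m: "0 \<le> m" "\<And>a. a \<in> G \<Longrightarrow> m * norm a < norm (T a)"
    and orth: "\<And>a b. a \<in> G \<Longrightarrow> b \<in> G \<Longrightarrow> a \<noteq> b \<Longrightarrow> cinner a b = 0 \<and> cinner (T a) (T b) = 0"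
    and x: "x \<in> closure (cspan G)" "x \<noteq> 0"
  shows "m * norm x < norm (T x)"
proof -
  interpret T: bounded_linear T using T by (simp add: bounded_clinear_def)
  have TC: "T (c *\<^sub>C y) = c *\<^sub>C T y" for c y using T by (simp add: bounded_clinear_def)
  have sum: "m * norm (\<Sum>a\<in>F. r a *\<^sub>C a) \<le> norm (T (\<Sum>a\<in>F. r a *\<^sub>C a))"
    if "finite F" "F \<subseteq> G" for F r
    using that
  proof (induction F rule: finite_induct)
    case empty
    then show ?case by (simp add: T.zero)
  next
    case (insert a F)
    let ?y = "\<Sum>a\<in>F. r a *\<^sub>C a"
    have "cinner b a = 0 \<and> cinner (T b) (T a) = 0" if "b \<in> F" for b
      using that insert.prems insert.hyps by (intro orth) auto
    then have "cinner ?y a = 0 \<and> cinner (T ?y) (T a) = 0"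
      by (auto simp: T.sum TC cinner_sum_left cinner_scaleC_left intro!: sum.neutral)
    then have *: "cinner ?y (r a *\<^sub>C a) = 0" "cinner (T ?y) (r a *\<^sub>C T a) = 0"
      by (auto simp: cinner_scaleC_right)
    have "(m * norm (?y + r a *\<^sub>C a))\<^sup>2 = (m * norm ?y)\<^sup>2 + (cmod (r a))\<^sup>2 * (m * norm a)\<^sup>2"
      unfolding power_mult_distrib Pythagoras_cinner[OF *(1)] norm_scaleC
      by (simp add: algebra_simps)
    also have "\<dots> \<le> (norm (T ?y))\<^sup>2 + (cmod (r a))\<^sup>2 * (norm (T a))\<^sup>2"
      using insert m by (intro add_mono mult_left_mono power_mono) (auto simp: less_imp_le)
    also have "\<dots> = (norm (T (?y + r a *\<^sub>C a)))\<^sup>2"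
      by (simp add: T.add TC Pythagoras_cinner[OF *(2)] norm_scaleC power_mult_distrib)
    finally have "m * norm (?y + r a *\<^sub>C a) \<le> norm (T (?y + r a *\<^sub>C a))"
      by (rule power2_le_imp_le) simp
    then show ?case using insert by (simp add: add.commute)
  qed
  have "cspan G \<subseteq> {y. m * norm y \<le> norm (T y)}"
    using sum by (auto simp: complex_vector.span_explicit)
  moreover have "closed {y. m * norm y \<le> norm (T y)}"
    by (intro closed_Collect_le continuous_intros T.continuous_on)
  ultimately have le: "m * norm y \<le> norm (T y)" if "y \<in> closure (cspan G)" for y
    using closure_minimal that by blast
  have "\<exists>g\<in>G. cinner x g \<noteq> 0"
  proof (rule ccontr)
    assume "\<not> (\<exists>g\<in>G. cinner x g \<noteq> 0)"
    then have "x \<in> perp (G \<union> (*\<^sub>C) \<i> ` G)"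
      by (intro perp_if_cinner_zero) (auto simp: cinner_scaleC_right)
    then have "x \<in> perp (cspan G)" by (simp add: cspan_eq_span perp_span)
    then show False using perp_closure_self x by blast
  qed
  then obtain g where g: "g \<in> G" "cinner x g \<noteq> 0" by blast
  then have g0: "norm g > 0" by auto
  define \<rho> where "\<rho> = (norm (T g))\<^sup>2 / (norm g)\<^sup>2"
  have "cspan G \<subseteq> {y. cinner (T y) (T g) = of_real \<rho> * cinner y g}"
  proof (rule complex_vector.span_minimal)
    show "csubspace {y. cinner (T y) (T g) = of_real \<rho> * cinner y g}"
      by (rule complex_vector.subspaceI)
        (auto simp: T.zero T.add TC cinner_add_left cinner_scaleC_left algebra_simps)
    show "G \<subseteq> {y. cinner (T y) (T g) = of_real \<rho> * cinner y g}"
    proof safe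
      fix y assume "y \<in> G"
      then show "cinner (T y) (T g) = of_real \<rho> * cinner y g"
        using orth[of y g] g g0 by (cases "y = g") (auto simp: cinner_self \<rho>_def)
    qed
  qed
  moreover have "closed {y. cinner (T y) (T g) = of_real \<rho> * cinner y g}"
    by (intro closed_Collect_eq continuous_intros T.continuous_on)
  ultimately have eq: "cinner (T x) (T g) = of_real \<rho> * cinner x g"
    using closure_minimal x(1) by blast
  \<comment> \<open>the component of \<open>x\<close> along \<open>g\<close>; the rest is orthogonal to \<open>g\<close>, and its image to \<open>T g\<close>\<close>
  define k where "k = cinner x g / of_real ((norm g)\<^sup>2)"
  define x' where "x' = x - k *\<^sub>C g"
  have "cinner x' g = 0" "cinner (T x') (T g) = 0"
    using g0 by (auto simp: x'_def k_def T.diff TC cinner_diff_left cinner_scaleC_left cinner_self eq \<rho>_def)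
  then have *: "cinner x' (k *\<^sub>C g) = 0" "cinner (T x') (k *\<^sub>C T g) = 0"
    by (auto simp: cinner_scaleC_right)
  have x'in: "x' \<in> closure (cspan G)" unfolding x'_def
    using x(1) g closure_subset complex_vector.span_base[of g G]
    by (intro complex_vector.subspace_diff complex_vector.subspace_scale csubspace_closure
        complex_vector.subspace_span) auto
  have k0: "k \<noteq> 0" using g g0 by (simp add: k_def)
  have x_eq: "x = x' + k *\<^sub>C g" by (simp add: x'_def)
  have "(m * norm x)\<^sup>2 = (m * norm x')\<^sup>2 + (cmod k)\<^sup>2 * (m * norm g)\<^sup>2"
    unfolding x_eq power_mult_distrib Pythagoras_cinner[OF *(1)] norm_scaleC
    by (simp add: algebra_simps)
  also have "\<dots> < (norm (T x'))\<^sup>2 + (cmod k)\<^sup>2 * (norm (T g))\<^sup>2"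
    using le[OF x'in] m(1) m(2)[OF g(1)] k0
    by (intro add_le_less_mono mult_strict_left_mono power_mono power_strict_mono) auto
  also have "\<dots> = (norm (T x))\<^sup>2"
    unfolding x_eq by (simp add: T.add TC Pythagoras_cinner[OF *(2)] norm_scaleC power_mult_distrib)
  finally show ?thesis by (rule power_less_imp_less_base) simp
qed

section \<open>Spectra of self-adjoint operators\<close>

definition bounded_below :: "('a::real_normed_vector \<Rightarrow> 'b::real_normed_vector) \<Rightarrow> bool"
  where "bounded_below f \<longleftrightarrow> (\<exists>c>0. \<forall>x. c * norm x \<le> norm (f x))"

lemma bounded_below_comp:
  assumes "bounded_below f" "bounded_below g"
  shows "bounded_below (\<lambda>x. f (g x))"
proof -
  obtain c d where c: "c > 0" "\<And>x. c * norm x \<le> norm (f x)"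
    and d: "d > 0" "\<And>x. d * norm x \<le> norm (g x)"
    using assms by (auto simp: bounded_below_def)
  have "c * d * norm x \<le> norm (f (g x))" for x
    unfolding mult.assoc using c(1) by (intro order_trans[OF mult_left_mono[OF d(2)] c(2)]) simp
  then show ?thesis unfolding bounded_below_def using c d by (intro exI[of _ "c * d"]) auto
qed

lemma invertible_imp_bounded_below:
  assumes "invertible_op f" shows "bounded_below f"
proof -
  obtain S where S: "bounded_clinear S" "S \<circ> f = id" using assms by (auto simp: invertible_op_def)
  then obtain K where K: "K > 0" "\<And>x. norm (S x) \<le> norm x * K"
    using bounded_linear.pos_bounded[of S] by (auto simp: bounded_clinear_def)
  have "1 / K * norm x \<le> norm (f x)" for x
    using K(2)[of "f x"] K(1) fun_cong[OF S(2), of x] by (simp add: field_simps)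
  then show ?thesis unfolding bounded_below_def using K by (intro exI[of _ "1/K"]) auto
qed

locale selfadjoint_operator =
  fixes T :: "'a::chilbert_space \<Rightarrow> 'a"
  assumes bcl: "bounded_clinear T" and sa: "selfadjoint T"
begin

sublocale T: bounded_linear T
  using bcl by (simp add: bounded_clinear_def)

lemma T_scaleC: "T (c *\<^sub>C x) = c *\<^sub>C T x"
  using bcl by (simp add: bounded_clinear_def)

lemma cinner_T: "cinner (T x) y = cinner x (T y)"
  using sa by (simp add: selfadjoint_def is_cadjoint_def)

lemma inner_T: "inner (T x) y = inner x (T y)"
  by (simp add: inner_eq_Re_cinner cinner_T)

lemma bounded_clinear_shift: "bounded_clinear (\<lambda>x. T x - \<mu> *\<^sub>C x)"
  unfolding bounded_clinear_def
  by (auto intro!: bounded_linear_sub T.bounded_linear_axioms bounded_linear_scaleC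
      simp: T_scaleC complex_vector.scale_right_diff_distrib scaleC_scaleC mult.commute)

lemma shift: "selfadjoint_operator (\<lambda>x. T x - l *\<^sub>R x)"
proof
  show "bounded_clinear (\<lambda>x. T x - l *\<^sub>R x)"
    unfolding scaleR_scaleC by (rule bounded_clinear_shift)
  have "cinner (T x - l *\<^sub>R x) y = cinner x (T y - l *\<^sub>R y)" for x y
    unfolding scaleR_scaleC
    by (simp add: cinner_diff_left cinner_diff_right cinner_T cinner_scaleC_left cinner_scaleC_right)
  then show "selfadjoint (\<lambda>x. T x - l *\<^sub>R x)"
    by (simp add: selfadjoint_def is_cadjoint_def)
qed

lemma square: "selfadjoint_operator (\<lambda>x. T (T x))"
proof
  show "bounded_clinear (\<lambda>x. T (T x))"
    unfolding bounded_clinear_def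
    by (auto intro!: bounded_linear_compose[OF T.bounded_linear_axioms] T.bounded_linear_axioms simp: T_scaleC)
  show "selfadjoint (\<lambda>x. T (T x))" by (simp add: selfadjoint_def is_cadjoint_def cinner_T)
qed

text \<open>
  The range is closed because it is complete, and a vector orthogonal to it lies in the kernel of
  the adjoint \<open>T - cnj \<mu>\<close>.
\<close>

lemma invertible_if_bounded_below:
  assumes bb: "bounded_below (\<lambda>x. T x - \<mu> *\<^sub>C x)"
    and ker: "\<And>x. T x = cnj \<mu> *\<^sub>C x \<Longrightarrow> x = 0"
  shows "invertible_op (\<lambda>x. T x - \<mu> *\<^sub>C x)"
proof -
  define f where "f x = T x - \<mu> *\<^sub>C x" for x
  have fc: "bounded_clinear f" unfolding f_def by (rule bounded_clinear_shift)
  interpret f: bounded_linear f using fc by (simp add: bounded_clinear_def)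
  obtain c where c: "c > 0" "\<And>x. c * norm x \<le> norm (f x)"
    using bb by (auto simp: bounded_below_def f_def)
  have "complete (range f)"
    by (rule complete_isometric_image[OF c(1) subspace_UNIV f.bounded_linear_axioms])
      (use c in \<open>auto simp: complete_UNIV\<close>)
  then have cl: "closed (range f)" by (rule complete_imp_closed)
  have sub: "subspace (range f)" using f.linear_axioms subspace_UNIV by (rule linear_subspace_image)
  have surj: "y \<in> range f" for y
  proof -
    obtain r where r: "r \<in> range f" "y - r \<in> perp (range f)"
      using projection_exists[OF sub cl] by blast
    define z where "z = y - r"
    have "inner x (T z - cnj \<mu> *\<^sub>C z) = 0" for x
      using perpD[OF r(2), of "f x"]
      by (simp add: z_def[symmetric] f_def inner_commute[of z] inner_diff_left inner_diff_right
          inner_T inner_scaleC_left)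
    then have "T z = cnj \<mu> *\<^sub>C z" using inner_eq_zero_iff by (metis right_minus_eq)
    then have "z = 0" by (rule ker)
    then show ?thesis using r by (simp add: z_def)
  qed
  have inj: "inj f"
  proof (rule injI)
    fix x y assume "f x = f y"
    then show "x = y" using c(2)[of "x - y"] c(1) by (simp add: f.diff mult_le_0_iff)
  qed
  define S where "S = inv f"
  have fS: "f (S y) = y" for y using surj by (simp add: S_def f_inv_into_f)
  have Sf: "S (f x) = x" for x using inj by (simp add: S_def)
  have "bounded_linear S"
  proof (rule bounded_linear_intro[of _ "1 / c"])
    show "S (x + y) = S x + S y" for x y using Sf[of "S x + S y"] by (simp add: f.add fS)
    show "S (r *\<^sub>R x) = r *\<^sub>R S x" for r x using Sf[of "r *\<^sub>R S x"] by (simp add: f.scaleR fS)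
    show "norm (S x) \<le> norm x * (1 / c)" for x using c(2)[of "S x"] c(1) by (simp add: fS field_simps)
  qed
  moreover have "S (r *\<^sub>C x) = r *\<^sub>C S x" for r x
    using Sf[of "r *\<^sub>C S x"] fc by (simp add: bounded_clinear_def fS)
  ultimately have "bounded_clinear S" by (simp add: bounded_clinear_def)
  then show ?thesis unfolding invertible_op_def f_def[symmetric]
    by (intro exI[of _ S]) (auto simp: fS Sf fun_eq_iff)
qed

lemma real_spectrum_iff:
  "complex_of_real l \<in> spectrum_op T \<longleftrightarrow> \<not> bounded_below (\<lambda>x. T x - l *\<^sub>R x)"
proof -
  have "x = 0" if bb: "bounded_below (\<lambda>x. T x - l *\<^sub>R x)" and x: "T x = cnj (complex_of_real l) *\<^sub>C x" for x
  proof -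
    obtain c where "c > 0" "c * norm x \<le> norm (T x - l *\<^sub>R x)"
      using bb by (auto simp: bounded_below_def)
    then show ?thesis using x by (simp add: scaleR_scaleC mult_le_0_iff)
  qed
  then have "bounded_below (\<lambda>x. T x - l *\<^sub>R x) \<Longrightarrow> invertible_op (\<lambda>x. T x - complex_of_real l *\<^sub>C x)"
    by (intro invertible_if_bounded_below) (simp add: scaleR_scaleC)
  then show ?thesis
    using invertible_imp_bounded_below by (auto simp: spectrum_op_def scaleR_scaleC)
qed

lemma Im_cinner_T_self: "Im (cinner (T x) x) = 0"
  using arg_cong[OF cinner_commute[of "T x" x], of Im] by (simp add: cinner_T)

text \<open>
  The form of a self-adjoint operator is real, so \<open>Im \<mu>\<close> bounds the form of \<open>T - \<mu>\<close> from below.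
\<close>

lemma Im_le_norm_shift: "\<bar>Im \<mu>\<bar> * norm x \<le> norm (T x - \<mu> *\<^sub>C x)"
proof (cases "x = 0")
  case False
  have "\<bar>Im \<mu>\<bar> * (norm x)\<^sup>2 = \<bar>Im (cinner (T x - \<mu> *\<^sub>C x) x)\<bar>"
    by (simp add: cinner_diff_left cinner_scaleC_left Im_cinner_T_self cinner_self abs_mult
        del: of_real_power)
  also have "\<dots> = \<bar>inner (T x - \<mu> *\<^sub>C x) (\<i> *\<^sub>C x)\<bar>" by (simp add: cinner_eq_inner)
  also have "\<dots> \<le> norm (T x - \<mu> *\<^sub>C x) * norm x"
    using Cauchy_Schwarz_ineq2[of "T x - \<mu> *\<^sub>C x" "\<i> *\<^sub>C x"] by (simp add: norm_scaleC)
  finally show ?thesis using False by (simp add: power2_eq_square)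
qed (simp add: T.zero)

lemma spectrum_real:
  assumes "\<mu> \<in> spectrum_op T" shows "\<mu> = complex_of_real (Re \<mu>)"
proof (rule ccontr)
  assume "\<mu> \<noteq> complex_of_real (Re \<mu>)"
  then have im: "\<bar>Im \<mu>\<bar> > 0" by (auto simp: complex_eq_iff)
  have "invertible_op (\<lambda>x. T x - \<mu> *\<^sub>C x)"
  proof (rule invertible_if_bounded_below)
    show "bounded_below (\<lambda>x. T x - \<mu> *\<^sub>C x)"
      unfolding bounded_below_def using im Im_le_norm_shift by blast
    show "x = 0" if "T x = cnj \<mu> *\<^sub>C x" for x
      using that im Im_le_norm_shift[of "cnj \<mu>" x] by (simp add: mult_le_0_iff)
  qed
  then show False using assms by (simp add: spectrum_op_def)
qed

section \<open>Isolated points of the spectrum\<close>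

text \<open>
  If the only point of the spectrum in \<open>(-d, d)\<close> is possibly \<open>0\<close>, then \<open>T\<^sup>2\<close> has no spectrum in
  \<open>(0, d\<^sup>2)\<close>. With \<open>m = d\<^sup>2 / 2\<close> the midpoint of this gap, the operator \<open>C = T\<^sup>2 - m\<close> should therefore
  satisfy \<open>norm (C y) \<ge> m * norm y\<close>, and squaring this inequality gives the claim. Suppose the
  infimum \<open>c\<close> of \<open>norm (C y)\<close> over unit vectors were smaller than \<open>m\<close>. Almost minimizing vectors
  are almost annihilated by \<open>C\<^sup>2 - c\<^sup>2\<close>. But this operator is
  \<open>(T\<^sup>2 - (m + c)) (T\<^sup>2 - (m - c))\<close>, a product of four factors \<open>T \<plusminus> s\<close> with \<open>0 < s < d\<close>, each of which
  is bounded below.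
\<close>

lemma square_expands:
  assumes d: "d > 0"
    and bb: "\<And>t. t \<noteq> 0 \<Longrightarrow> \<bar>t\<bar> < d \<Longrightarrow> bounded_below (\<lambda>x. T x - t *\<^sub>R x)"
  shows "d * norm (T y) \<le> norm (T (T y))"
proof -
  define m where "m = d\<^sup>2 / 2"
  define C where "C x = T (T x) - m *\<^sub>R x" for x
  interpret TT: selfadjoint_operator "\<lambda>x. T (T x)" by (rule square)
  interpret C: selfadjoint_operator C unfolding C_def by (rule TT.shift)
  interpret CC: selfadjoint_operator "\<lambda>x. C (C x)" by (rule C.square)
  have key: "m * norm y \<le> norm (C y)"
  proof (rule ccontr)
    assume less: "\<not> m * norm y \<le> norm (C y)"
    then have y0: "y \<noteq> 0" by (auto simp: C.T.zero)
    define E where "E = {norm (C x) |x. norm x = 1}"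
    define c where "c = Inf E"
    let ?y = "(1 / norm y) *\<^sub>R y"
    have yE: "norm (C ?y) \<in> E" using y0 by (auto simp: E_def)
    have bdd: "bdd_below E" by (auto simp: E_def intro: bdd_belowI[of _ 0])
    have c0: "c \<ge> 0" unfolding c_def using yE by (intro cInf_greatest) (auto simp: E_def)
    have "c \<le> norm (C ?y)" unfolding c_def using yE bdd by (rule cInf_lower)
    also have "\<dots> < m" using less y0 by (simp add: C.T.scaleR field_simps)
    finally have cm: "c < m" .
    have "c \<le> norm (C x)" if "norm x = 1" for x
      unfolding c_def using that by (intro cInf_lower[OF _ bdd]) (auto simp: E_def)
    then have cle: "c * norm x \<le> norm (C x)" for x
      using norm_ge_from_unit_sphere[OF C.T.linear_axioms subspace_UNIV] by blast
    define D where "D x = C (C x) - c\<^sup>2 *\<^sub>R x" for x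
    interpret D: selfadjoint_operator D unfolding D_def by (rule CC.shift)
    have form: "inner (D x) x = (norm (C x))\<^sup>2 - c\<^sup>2 * (norm x)\<^sup>2" for x
      by (simp add: D_def inner_diff_left C.inner_T power2_norm_eq_inner)
    have "m + c < d\<^sup>2" using cm by (simp add: m_def)
    then have rt: "sqrt (m + c) < d" "sqrt (m - c) < d" "sqrt (m + c) > 0" "sqrt (m - c) > 0"
      using d c0 cm by (auto intro!: real_less_lsqrt)
    have sq: "(sqrt (m + c))\<^sup>2 = m + c" "(sqrt (m - c))\<^sup>2 = m - c" using c0 cm by auto
    have fac: "(\<lambda>x. T (T x - (- s) *\<^sub>R x) - s *\<^sub>R (T x - (- s) *\<^sub>R x)) = (\<lambda>x. T (T x) - s\<^sup>2 *\<^sub>R x)" for s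
      by (simp add: fun_eq_iff T.add T.scaleR algebra_simps power2_eq_square)
    have bb2: "bounded_below (\<lambda>x. T (T x) - s\<^sup>2 *\<^sub>R x)" if "0 < s" "s < d" for s
      unfolding fac[symmetric] by (rule bounded_below_comp[of "\<lambda>x. T x - s *\<^sub>R x"])
        (use bb[of s] bb[of "- s"] that in auto)
    have D_eq: "D = (\<lambda>x. (\<lambda>x. T (T x) - (m + c) *\<^sub>R x) (T (T x) - (m - c) *\<^sub>R x))"
      by (simp add: fun_eq_iff D_def C_def T.diff T.add T.scaleR algebra_simps power2_eq_square)
    have "bounded_below D" unfolding D_eq
      by (rule bounded_below_comp) (use bb2[of "sqrt (m + c)"] bb2[of "sqrt (m - c)"] rt sq in auto)
    then obtain k where k: "k > 0" "\<And>x. k * norm x \<le> norm (D x)"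
      by (auto simp: bounded_below_def)
    define K where "K = (onorm C)\<^sup>2 + 1"
    have K: "K > 0" unfolding K_def by (smt (verit) zero_le_power2)
    have Kle: "inner (D x) x \<le> K * (norm x)\<^sup>2" for x
    proof -
      have "(norm (C x))\<^sup>2 \<le> (onorm C * norm x)\<^sup>2"
        by (intro power_mono onorm C.T.bounded_linear_axioms) auto
      also have "\<dots> \<le> K * (norm x)\<^sup>2" by (simp add: K_def power_mult_distrib algebra_simps)
      finally show ?thesis using form[of x] by (smt (verit) mult_nonneg_nonneg zero_le_power2)
    qed
    \<comment> \<open>almost minimizing vectors, close enough to contradict the lower bound \<open>k\<close> for \<open>D\<close>\<close>
    have "sqrt (c\<^sup>2 + k\<^sup>2 / K) > c" using c0 k K by (intro real_less_rsqrt) auto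
    then obtain x where x: "norm x = 1" "norm (C x) < sqrt (c\<^sup>2 + k\<^sup>2 / K)"
      using cInf_less_iff[of E "sqrt (c\<^sup>2 + k\<^sup>2 / K)"] yE bdd by (auto simp: c_def E_def)
    have "(norm (C x))\<^sup>2 < (sqrt (c\<^sup>2 + k\<^sup>2 / K))\<^sup>2" using x by (intro power_strict_mono) auto
    then have "inner (D x) x < k\<^sup>2 / K" using x K by (simp add: form)
    then have "K * inner (D x) x < k\<^sup>2" using K by (simp add: field_simps)
    moreover have "(norm (D x))\<^sup>2 \<le> K * inner (D x) x"
    proof (rule symmetric_form_bound[of _ UNIV])
      show "0 \<le> inner (D y) y" for y
        using power_mono[OF cle[of y], of 2] c0 by (simp add: form power_mult_distrib)
    qed (use D.T.linear_axioms D.inner_T Kle K in auto)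
    moreover have "k\<^sup>2 \<le> (norm (D x))\<^sup>2" using k(2)[of x] k(1) x by (intro power_mono) auto
    ultimately show False by linarith
  qed
  then have "(m * norm y)\<^sup>2 \<le> (norm (C y))\<^sup>2" by (rule power_mono) (simp add: m_def)
  moreover have "(norm (C y))\<^sup>2 = (norm (T (T y)))\<^sup>2 - 2 * m * (norm (T y))\<^sup>2 + m\<^sup>2 * (norm y)\<^sup>2"
    unfolding C_def norm_diff_scaleR_squared
    using inner_T[of "T y" y] by (simp add: power2_norm_eq_inner)
  ultimately have "d\<^sup>2 * (norm (T y))\<^sup>2 \<le> (norm (T (T y)))\<^sup>2"
    by (simp only: m_def power_mult_distrib)
  then have "(d * norm (T y))\<^sup>2 \<le> (norm (T (T y)))\<^sup>2" by (simp only: power_mult_distrib)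
  then show ?thesis by (rule power2_le_imp_le) simp
qed

text \<open>
  The lower bound holds on the range by the previous lemma, hence on its closure, and the closure of
  the range of a self-adjoint operator is the orthogonal complement of the kernel.
\<close>

lemma bounded_below_off_kernel:
  assumes d: "d > 0"
    and bb: "\<And>t. t \<noteq> 0 \<Longrightarrow> \<bar>t\<bar> < d \<Longrightarrow> bounded_below (\<lambda>x. T x - t *\<^sub>R x)"
    and x: "x \<in> perp {z. T z = 0}"
  shows "d * norm x \<le> norm (T x)"
proof -
  have R: "csubspace (closure (range T))"
  proof (rule csubspace_closure, rule complex_vector.subspaceI)
    show "0 \<in> range T" by (rule range_eqI[of _ _ 0]) (simp add: T.zero)
    show "u + v \<in> range T" if "u \<in> range T" "v \<in> range T" for u v
      using that by (auto simp: T.add[symmetric])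
    show "c *\<^sub>C u \<in> range T" if "u \<in> range T" for c u
      using that by (auto simp: T_scaleC[symmetric])
  qed
  obtain r where r: "r \<in> closure (range T)" "x - r \<in> perp (closure (range T))"
    using projection_exists[OF csubspace_imp_subspace[OF R] closed_closure] by blast
  define z where "z = x - r"
  have "inner (T z) y = 0" for y
    unfolding inner_T z_def by (intro perpD[OF r(2)] subsetD[OF closure_subset] rangeI)
  from this[of "T z"] have "T z = 0" by simp
  then have "inner x z = 0" using perpD[OF x] by simp
  moreover have "inner r z = 0"
    using perpD[OF r(2) r(1)] by (simp add: z_def inner_commute)
  ultimately have "inner z z = 0" by (metis inner_diff_left z_def diff_0_right)
  then have "z = 0" by simp
  then have xr: "x \<in> closure (range T)" using r by (simp add: z_def)
  have "range T \<subseteq> {y. d * norm y \<le> norm (T y)}" using square_expands[OF d bb] by auto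
  moreover have "closed {y. d * norm y \<le> norm (T y)}"
    by (intro closed_Collect_le continuous_intros T.continuous_on)
  ultimately show ?thesis using closure_minimal xr by blast
qed

lemma isolated_bounded_below_off_eigenspace:
  assumes "complex_of_real l isolated_in spectrum_op T"
  obtains d where "d > 0"
    "\<And>x. x \<in> perp (eigenspace_op T (complex_of_real l)) \<Longrightarrow> d * norm x \<le> norm (T x - l *\<^sub>R x)"
proof -
  obtain d where d: "d > 0" "\<And>y. y \<in> spectrum_op T \<Longrightarrow> dist (complex_of_real l) y < d \<Longrightarrow> y = of_real l"
    using assms by (auto simp: isolated_in_dist_Ex_iff)
  interpret A: selfadjoint_operator "\<lambda>x. T x - l *\<^sub>R x" by (rule shift)
  have "bounded_below (\<lambda>x. (T x - l *\<^sub>R x) - t *\<^sub>R x)" if "t \<noteq> 0" "\<bar>t\<bar> < d" for t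
  proof -
    have "dist (complex_of_real l) (complex_of_real (l + t)) < d"
      using that by (simp add: dist_norm)
    then have "complex_of_real (l + t) \<notin> spectrum_op T" using d(2)[of "of_real (l + t)"] that by auto
    then show ?thesis unfolding real_spectrum_iff by (simp add: algebra_simps)
  qed
  moreover have "eigenspace_op T (complex_of_real l) = {z. T z - l *\<^sub>R z = 0}"
    by (auto simp: eigenspace_op_def scaleR_scaleC)
  ultimately show thesis using that[OF d(1)] A.bounded_below_off_kernel[OF d(1)] by auto
qed

end

section \<open>A criterion for the essential spectrum\<close>

text \<open>
  The singular sequences of Weyl's criterion, expressed without sequences: approximate eigenvectors
  exist outside any finitely many directions. For self-adjoint operators these \<open>l\<close> turn out to be
  exactly the points of the essential spectrum.
\<close>

definition weyl :: "('a::real_inner \<Rightarrow> 'a) \<Rightarrow> real \<Rightarrow> bool"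
  where "weyl T l \<longleftrightarrow>
    (\<forall>S e. finite S \<longrightarrow> e > 0 \<longrightarrow> (\<exists>x\<in>perp S. norm x = 1 \<and> norm (T x - l *\<^sub>R x) < e))"

lemma weylE:
  assumes "weyl T l" "finite S" "e > 0"
  obtains x where "x \<in> perp S" "norm x = 1" "norm (T x - l *\<^sub>R x) < e"
  using assms unfolding weyl_def by blast

lemma cfinite_dim_realE:
  fixes M :: "'a::complex_inner set"
  assumes "cfinite_dim M"
  obtains S where "finite S" "span S = M"
  using assms cspan_eq_span unfolding cfinite_dim_def by (metis finite_UnI finite_imageI)

text \<open>
  Along the segment from \<open>e\<close> to \<open>f\<close> the function \<open>norm (T z) - m * norm z\<close> changes sign. The segment
  avoids \<open>0\<close> because \<open>f = - e\<close> would give \<open>norm (T f) = norm (T e)\<close>.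
\<close>

lemma intermediate_norm:
  fixes T :: "'a::real_normed_vector \<Rightarrow> 'b::real_normed_vector"
  assumes T: "bounded_linear T" and V: "subspace V" "e \<in> V" "f \<in> V" "norm e = 1" "norm f = 1"
    and m: "norm (T e) < m" "m < norm (T f)"
  obtains x where "x \<in> V" "norm x = 1" "norm (T x) = m"
proof -
  interpret T: bounded_linear T by (rule T)
  define z where "z t = (1 - t) *\<^sub>R e + t *\<^sub>R f" for t :: real
  have zV: "z t \<in> V" for t unfolding z_def by (intro subspace_add subspace_scale V)
  have cont: "continuous_on {0..1} (\<lambda>t. norm (T (z t)) - m * norm (z t))"
    unfolding z_def by (intro continuous_intros T.continuous_on)
  have "\<exists>t\<ge>0. t \<le> 1 \<and> norm (T (z t)) - m * norm (z t) = 0"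
    by (rule IVT'[OF _ _ _ cont]) (use m V in \<open>auto simp: z_def\<close>)
  then obtain t where t: "0 \<le> t" "t \<le> 1" "norm (T (z t)) = m * norm (z t)" by auto
  have "z t \<noteq> 0"
  proof
    assume "z t = 0"
    then have eq: "(1 - t) *\<^sub>R e = - (t *\<^sub>R f)" by (simp add: z_def eq_neg_iff_add_eq_0)
    then have "norm ((1 - t) *\<^sub>R e) = norm (t *\<^sub>R f)" by simp
    then have half: "t = 1/2" using t V by simp
    from eq have "(1/2::real) *\<^sub>R e = (1/2) *\<^sub>R (- f)" unfolding half by simp
    then have "e = - f" by (simp only: scaleR_cancel_left) simp
    then show False using m by (simp add: linear_neg[OF T.linear_axioms])
  qed
  then show thesis
    using that[of "(1 / norm (z t)) *\<^sub>R z t"] normalize_in_subspace[OF V(1) zV] t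
    by (simp add: T.scaleR)
qed

context selfadjoint_operator
begin

lemma csubspace_eigenspace: "csubspace (eigenspace_op T \<mu>)"
  by (rule complex_vector.subspaceI)
    (auto simp: eigenspace_op_def T.zero T.add T_scaleC scaleC_add_right scaleC_scaleC
      complex_vector.scale_zero_right mult.commute)

lemma eigenvalue_in_spectrum:
  assumes "eigenvalue_op T (complex_of_real l)"
  shows "complex_of_real l \<in> spectrum_op T" and "\<bar>l\<bar> \<le> onorm T"
proof -
  obtain x where x: "x \<noteq> 0" "T x = l *\<^sub>R x"
    using assms by (auto simp: eigenvalue_op_def scaleR_scaleC)
  show "complex_of_real l \<in> spectrum_op T"
  proof (rule ccontr)
    assume "complex_of_real l \<notin> spectrum_op T"
    then obtain c where "c > 0" "c * norm x \<le> norm (T x - l *\<^sub>R x)"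
      by (auto simp: real_spectrum_iff bounded_below_def)
    then show False using x by (simp add: mult_le_0_iff)
  qed
  show "\<bar>l\<bar> \<le> onorm T"
    using onorm[OF T.bounded_linear_axioms, of x] x by simp
qed

text \<open>
  Near an isolated eigenvalue of finite multiplicity \<open>T - l\<close> is bounded below outside the
  finite-dimensional eigenspace, which excludes singular vectors.
\<close>

lemma weyl_imp_essential:
  assumes "weyl T l" shows "complex_of_real l \<in> essential_spectrum T"
proof -
  have "\<not> bounded_below (\<lambda>x. T x - l *\<^sub>R x)"
  proof
    assume "bounded_below (\<lambda>x. T x - l *\<^sub>R x)"
    then obtain c where c: "c > 0" "\<And>x. c * norm x \<le> norm (T x - l *\<^sub>R x)"
      by (auto simp: bounded_below_def)
    obtain x where "norm x = 1" "norm (T x - l *\<^sub>R x) < c"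
      using weylE[OF assms finite.emptyI c(1)] by blast
    then show False using c(2)[of x] by simp
  qed
  moreover have "complex_of_real l \<notin> discrete_spectrum T"
  proof
    assume "complex_of_real l \<in> discrete_spectrum T"
    then have l: "complex_of_real l isolated_in spectrum_op T"
      "cfinite_dim (eigenspace_op T (complex_of_real l))" by (auto simp: discrete_spectrum_def)
    obtain d where d: "d > 0" "\<And>x. x \<in> perp (eigenspace_op T (complex_of_real l))
        \<Longrightarrow> d * norm x \<le> norm (T x - l *\<^sub>R x)"
      using isolated_bounded_below_off_eigenspace[OF l(1)] by blast
    obtain S where S: "finite S" "span S = eigenspace_op T (complex_of_real l)"
      using cfinite_dim_realE[OF l(2)] by blast
    obtain x where "x \<in> perp S" "norm x = 1" "norm (T x - l *\<^sub>R x) < d"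
      using weylE[OF assms S(1) d(1)] by blast
    then show False using d(2)[of x] S(2) by (simp add: perp_span[of S, symmetric])
  qed
  ultimately show ?thesis by (simp add: essential_spectrum_def real_spectrum_iff)
qed

text \<open>
  Without singular vectors, \<open>A = T - l\<close> is bounded below outside a finite set of directions. So its
  kernel \<open>N\<close> has finite dimension, and the infimum of \<open>norm (A x)\<close> over unit vectors orthogonal to
  \<open>N\<close> is either attained or at least the positive bound from the failure of \<open>weyl\<close>. Attained
  at a vector outside the kernel, it is positive as well. Thus \<open>A\<close> splits orthogonally into \<open>0\<close> on
  \<open>N\<close> and a part bounded below by some \<open>c > 0\<close>. Hence \<open>N \<noteq> {0}\<close>, and all \<open>t\<close> with
  \<open>0 < \<bar>t - l\<bar> < c\<close> lie outside the spectrum.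
\<close>

lemma spectrum_imp_weyl_or_discrete:
  assumes l: "complex_of_real l \<in> spectrum_op T" and nw: "\<not> weyl T l"
  shows "complex_of_real l \<in> discrete_spectrum T"
proof -
  define N where "N = eigenspace_op T (complex_of_real l)"
  have N: "csubspace N" unfolding N_def by (rule csubspace_eigenspace)
  have Nsub: "subspace N" using N by (rule csubspace_imp_subspace)
  have N_iff: "x \<in> N \<longleftrightarrow> T x - l *\<^sub>R x = 0" for x
    by (simp add: N_def eigenspace_op_def scaleR_scaleC)
  interpret A: selfadjoint_operator "\<lambda>x. T x - l *\<^sub>R x" by (rule shift)
  obtain S e where S: "finite S" "e > 0"
    "\<And>x. x \<in> perp S \<Longrightarrow> norm x = 1 \<Longrightarrow> e \<le> norm (T x - l *\<^sub>R x)"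
    using nw unfolding weyl_def by (auto simp: not_less)
  have Se: "e * norm x \<le> norm (T x - l *\<^sub>R x)" if "x \<in> perp S" for x
    using A.T.linear_axioms subspace_perp S(3) that by (rule norm_ge_from_unit_sphere)
  have fin: "cfinite_dim N"
  proof (rule ccontr)
    assume "\<not> cfinite_dim N"
    then obtain x where "x \<in> N" "norm x = 1" "\<And>s. s \<in> S \<Longrightarrow> cinner x s = 0"
      using infinite_dim_meets_perp[OF N _ S(1)] by blast
    then show False using S(2) S(3)[OF perp_if_cinner_zero] by (fastforce simp: N_iff)
  qed
  obtain c where c: "c > 0" "\<And>x. x \<in> perp N \<Longrightarrow> c * norm x \<le> norm (T x - l *\<^sub>R x)"
  proof (cases "perp N = {0}")
    case True
    then show thesis using that[of 1] by simp
  next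
    case False
    define E where "E = {norm (T x - l *\<^sub>R x) |x. x \<in> perp N \<and> norm x = 1}"
    define m where "m = Inf E"
    obtain x0 where x0: "x0 \<in> perp N" "x0 \<noteq> 0" using False subspace_0[OF subspace_perp] by blast
    have E: "E \<noteq> {}" "bdd_below E"
      using normalize_in_subspace[OF subspace_perp x0]
      by (auto simp: E_def intro: bdd_belowI[of _ 0])
    have "m \<le> norm (T x - l *\<^sub>R x)" if "x \<in> perp N" "norm x = 1" for x
      unfolding m_def using that by (intro cInf_lower[OF _ E(2)]) (auto simp: E_def)
    with A.T.linear_axioms subspace_perp
    have mle: "m * norm x \<le> norm (T x - l *\<^sub>R x)" if "x \<in> perp N" for x
      using that by (rule norm_ge_from_unit_sphere)
    have "m > 0"
    proof (cases "m < e")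
      case True
      have "\<exists>x\<in>perp N. norm x = 1 \<and> norm (T x - l *\<^sub>R x) = m"
        by (rule infimum_attained[OF A.T.bounded_linear_axioms subspace_perp closed_perp False
              subspace_UNIV _ S(1) _ True]) (use Se in \<open>auto simp: m_def E_def\<close>)
      then obtain x where x: "x \<in> perp N" "norm x = 1" "norm (T x - l *\<^sub>R x) = m" by blast
      have "m \<noteq> 0"
      proof
        assume "m = 0"
        then have "x \<in> N" using x by (simp add: N_iff)
        then show False using perpD[OF x(1), of x] x(2) by simp
      qed
      then show ?thesis using x by (metis norm_ge_zero order_le_less)
    qed (use S(2) in simp)
    then show thesis using that mle by blast
  qed
  have "eigenvalue_op T (complex_of_real l)"
  proof (rule ccontr)
    assume "\<not> eigenvalue_op T (complex_of_real l)"
    then have "N \<subseteq> {0}" by (auto simp: N_def eigenspace_op_def eigenvalue_op_def)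
    then have "perp N = UNIV" by (auto simp: perp_def)
    then have "bounded_below (\<lambda>x. T x - l *\<^sub>R x)" using c unfolding bounded_below_def by auto
    then show False using l by (simp add: real_spectrum_iff)
  qed
  moreover have "complex_of_real l isolated_in spectrum_op T"
    unfolding isolated_in_dist_Ex_iff
  proof (intro conjI exI[of _ c] ballI impI l c(1))
    fix y assume y: "y \<in> spectrum_op T" "dist (complex_of_real l) y < c"
    obtain t where t: "y = complex_of_real t" using spectrum_real[OF y(1)] by metis
    define \<delta> where "\<delta> = t - l"
    have \<delta>c: "\<bar>\<delta>\<bar> < c" using y(2) by (simp add: t dist_norm \<delta>_def flip: of_real_diff)
    show "y = complex_of_real l"
    proof (rule ccontr)
      assume "y \<noteq> complex_of_real l"
      then have \<delta>0: "\<bar>\<delta>\<bar> > 0" by (auto simp: \<delta>_def t)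
      define k where "k = min \<bar>\<delta>\<bar> (c - \<bar>\<delta>\<bar>)"
      have k: "k > 0" "k \<le> \<bar>\<delta>\<bar>" "k \<le> c - \<bar>\<delta>\<bar>" using \<delta>0 \<delta>c by (auto simp: k_def)
      have "k * norm x \<le> norm (T x - t *\<^sub>R x)" for x
      proof -
        have "closed N"
        proof -
          have "N = {x. T x - l *\<^sub>R x = 0}" by (auto simp: N_iff)
          then show ?thesis
            by (auto intro!: closed_Collect_eq continuous_intros T.continuous_on)
        qed
        then obtain n where n: "n \<in> N" "x - n \<in> perp N"
          using projection_exists[OF Nsub] by blast
        define p where "p = x - n"
        have p: "p \<in> perp N" "x = p + n" using n by (auto simp: p_def)
        define w where "w = (T p - l *\<^sub>R p) - \<delta> *\<^sub>R p"
        have pn: "inner p n = 0" using perpD p(1) n(1) by blast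
        have "inner (T p - l *\<^sub>R p) n = 0" using A.inner_T[of p n] n(1) by (simp add: N_iff)
        then have wn: "inner w n = 0" by (simp add: w_def inner_diff_left pn)
        have eq: "T x - t *\<^sub>R x = w - \<delta> *\<^sub>R n"
          using n(1) by (simp add: N_iff p(2) w_def T.add \<delta>_def algebra_simps)
        have "k * norm p \<le> (c - \<bar>\<delta>\<bar>) * norm p" using k by (intro mult_right_mono) auto
        also have "\<dots> \<le> norm (T p - l *\<^sub>R p) - norm (\<delta> *\<^sub>R p)"
          using c(2)[OF p(1)] by (simp add: algebra_simps)
        also have "\<dots> \<le> norm w" unfolding w_def by (rule norm_triangle_ineq2)
        finally have kp: "k * norm p \<le> norm w" .
        have "(norm x)\<^sup>2 = (norm p)\<^sup>2 + (norm n)\<^sup>2"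
          using norm_diff_scaleR_squared[of p "-1" n] by (simp add: p(2) pn)
        then have "(k * norm x)\<^sup>2 = (k * norm p)\<^sup>2 + k\<^sup>2 * (norm n)\<^sup>2"
          by (simp add: power_mult_distrib algebra_simps)
        also have "\<dots> \<le> (norm w)\<^sup>2 + \<delta>\<^sup>2 * (norm n)\<^sup>2"
        proof (rule add_mono[OF power_mono[OF kp] mult_right_mono])
          show "k\<^sup>2 \<le> \<delta>\<^sup>2" using k power_mono[of k "\<bar>\<delta>\<bar>" 2] by simp
        qed (use k in auto)
        also have "\<dots> = (norm (w - \<delta> *\<^sub>R n))\<^sup>2"
          by (simp add: norm_diff_scaleR_squared wn)
        finally show ?thesis unfolding eq by (rule power2_le_imp_le) simp
      qed
      then have "bounded_below (\<lambda>x. T x - t *\<^sub>R x)" using k(1) unfolding bounded_below_def by blast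
      then show False using y(1) by (simp add: t real_spectrum_iff)
    qed
  qed
  ultimately show ?thesis using fin by (simp add: discrete_spectrum_def N_def)
qed

lemma essential_spectrum_eq_weyl: "essential_spectrum T = complex_of_real ` {l. weyl T l}"
proof
  show "complex_of_real ` {l. weyl T l} \<subseteq> essential_spectrum T"
    using weyl_imp_essential by auto
  show "essential_spectrum T \<subseteq> complex_of_real ` {l. weyl T l}"
  proof
    fix \<mu> assume \<mu>: "\<mu> \<in> essential_spectrum T"
    then have "\<mu> \<in> spectrum_op T" by (simp add: essential_spectrum_def)
    then obtain l where l: "\<mu> = complex_of_real l" using spectrum_real by metis
    then have "weyl T l"
      using \<mu> spectrum_imp_weyl_or_discrete[of l] by (auto simp: essential_spectrum_def)
    then show "\<mu> \<in> complex_of_real ` {l. weyl T l}" using l by blast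
  qed
qed

section \<open>Consequences of absolute minimum attainment\<close>

text \<open>
  Otherwise unit vectors with norms \<open>norm (T x)\<close> strictly above \<open>m\<close> but arbitrarily close to it exist
  outside any finitely many directions. Choosing them one by one, orthogonal to the earlier vectors
  \<open>y\<close> and to \<open>T (T y)\<close>, makes both the vectors and their images orthogonal families. On the closed
  span of the vectors the infimum of \<open>norm (T x)\<close> is \<open>m\<close>, but it is not attained.
\<close>

lemma absolutely_min_attaining_gap:
  assumes AM: "absolutely_min_attaining T" and m: "0 \<le> m"
  obtains S e where "finite S" "e > 0"
    "\<And>x. x \<in> perp S \<Longrightarrow> norm x = 1 \<Longrightarrow> m < norm (T x) \<Longrightarrow> m + e \<le> norm (T x)"
proof (rule ccontr)
  note choose = that
  assume "\<not> thesis"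
  then have H: "\<exists>x\<in>perp S. norm x = 1 \<and> m < norm (T x) \<and> norm (T x) < m + e"
    if "finite S" "e > 0" for S e using choose[OF that] not_less by blast
  define P where "P f n x \<longleftrightarrow> norm x = 1 \<and> m < norm (T x) \<and> norm (T x) < m + 1 / real (Suc n) \<and>
    (\<forall>i<n. cinner x (f i) = 0 \<and> cinner (T x) (T (f i)) = 0)" for f n x
  have "\<exists>g. \<forall>n. P g n (g n)"
  proof (rule dependent_wellorder_choice)
    show "P f n x = P g n x" if "\<And>k. k < n \<Longrightarrow> f k = g k" for x f g n
      using that by (auto simp: P_def)
    show "\<exists>x. P f n x" for n f
    proof -
      \<comment> \<open>\<open>cinner (T x) (T y) = cinner x (T (T y))\<close>, so orthogonality of the images is a condition on \<open>x\<close>\<close>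
      define F where "F = f ` {..<n} \<union> (\<lambda>x. T (T x)) ` f ` {..<n}"
      have "finite (F \<union> (*\<^sub>C) \<i> ` F)" by (simp add: F_def)
      then obtain x where x: "x \<in> perp (F \<union> (*\<^sub>C) \<i> ` F)" "norm x = 1"
        "m < norm (T x)" "norm (T x) < m + 1 / real (Suc n)"
        using H[of "F \<union> (*\<^sub>C) \<i> ` F" "1 / real (Suc n)"] by auto
      have "cinner x y = 0" if "y \<in> F" for y
        using that perpD[OF x(1)] by (simp add: cinner_eq_inner complex_eq_iff)
      then have "P f n x" using x by (auto simp: P_def F_def cinner_T)
      then show ?thesis ..
    qed
  qed
  then obtain g where g: "\<And>n. P g n (g n)" by blast
  have orth: "cinner (g i) (g j) = 0 \<and> cinner (T (g i)) (T (g j)) = 0" if "i \<noteq> j" for i j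
  proof (cases "j < i")
    case True
    then show ?thesis using g[of i] by (simp add: P_def)
  next
    case False
    then have "cinner (g j) (g i) = 0 \<and> cinner (T (g j)) (T (g i)) = 0"
      using g[of j] that by (simp add: P_def)
    then show ?thesis
      using cinner_commute[of "g i" "g j"] cinner_commute[of "T (g i)" "T (g j)"] by simp
  qed
  define M where "M = closure (cspan (range g))"
  have M: "csubspace M" "closed M" by (auto simp: M_def intro: csubspace_closure)
  have gM: "g n \<in> M" for n
    unfolding M_def by (rule subsetD[OF closure_subset], rule complex_vector.span_base) simp
  have "g 0 \<noteq> 0" using g[of 0] by (auto simp: P_def)
  then have "M \<noteq> {0}" using gM[of 0] by auto
  then have "min_attaining_on M T"
    using AM M by (simp add: absolutely_min_attaining_def)
  then obtain x where x: "x \<in> M" "norm x = 1" "norm (T x) = min_modulus_on M T"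
    by (auto simp: min_attaining_on_def)
  have leg: "norm (T x) \<le> norm (T (g n))" for n
    unfolding x(3) min_modulus_on_def
    by (rule cInf_lower) (use gM g[of n] in \<open>auto simp: P_def intro: bdd_belowI[of _ 0]\<close>)
  then have le: "norm (T x) < m + 1 / real (Suc n)" for n
    using leg[of n] g[of n] unfolding P_def by linarith
  have "m * norm x < norm (T x)"
  proof (rule norm_gt_on_orthogonal_closed_span[OF bcl m])
    show "x \<in> closure (cspan (range g))" "x \<noteq> 0" using x by (auto simp: M_def)
    show "m * norm a < norm (T a)" if "a \<in> range g" for a
      using that g by (auto simp: P_def)
    show "cinner a c = 0 \<and> cinner (T a) (T c) = 0"
      if ac: "a \<in> range g" "c \<in> range g" "a \<noteq> c" for a c
    proof -
      obtain i j where "a = g i" "c = g j" using ac by blast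
      then show ?thesis using ac(3) orth[of i j] by blast
    qed
  qed
  then have "norm (T x) - m > 0" using x by simp
  then obtain n where "inverse (real (Suc n)) < norm (T x) - m" using reals_Archimedean by blast
  then show False using le[of n] by (simp add: inverse_eq_divide)
qed

text \<open>
  Eigenvectors for infinitely many eigenvalues above \<open>b\<close> are orthogonal, so some unit vector of
  their span is orthogonal to \<open>S\<close>. On this span \<open>T\<close> stretches by more than \<open>b\<close>.
\<close>

lemma finitely_many_eigenvalues_above:
  assumes S: "finite S" "\<And>x. x \<in> perp S \<Longrightarrow> norm (T x) \<le> b * norm x" and b: "0 \<le> b"
  shows "finite {t. b < t \<and> eigenvalue_op T (complex_of_real t)}"
proof (rule ccontr)
  define X where "X = {t. b < t \<and> eigenvalue_op T (complex_of_real t)}"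
  assume "infinite {t. b < t \<and> eigenvalue_op T (complex_of_real t)}"
  then have inf: "infinite X" by (simp add: X_def)
  have "\<exists>v. \<forall>t\<in>X. v t \<noteq> 0 \<and> T (v t) = complex_of_real t *\<^sub>C v t"
    by (rule bchoice) (auto simp: X_def eigenvalue_op_def)
  then obtain v where v: "\<And>t. t \<in> X \<Longrightarrow> v t \<noteq> 0"
    "\<And>t. t \<in> X \<Longrightarrow> T (v t) = complex_of_real t *\<^sub>C v t" by blast
  have orth: "cinner (v s) (v t) = 0" if "s \<in> X" "t \<in> X" "s \<noteq> t" for s t
    using cinner_T[of "v s" "v t"] that v by (simp add: cinner_scaleC_left cinner_scaleC_right)
  have inj: "inj_on v X"
  proof (rule inj_onI, rule ccontr)
    fix s t assume "s \<in> X" "t \<in> X" "v s = v t" "s \<noteq> t"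
    then show False using orth[of s t] v(1)[of t] by (simp add: cinner_self)
  qed
  define G where "G = v ` X"
  have G: "a \<noteq> 0" "b * norm a < norm (T a)" if "a \<in> G" for a
    using that v b by (auto simp: G_def norm_scaleC X_def)
  have Gorth: "cinner a c = 0 \<and> cinner (T a) (T c) = 0" if ac: "a \<in> G" "c \<in> G" "a \<noteq> c" for a c
  proof -
    obtain s t where "s \<in> X" "t \<in> X" "a = v s" "c = v t" using ac unfolding G_def by blast
    then show ?thesis
      using ac orth[of s t] v(2) by (auto simp: cinner_scaleC_left cinner_scaleC_right)
  qed
  have "\<not> complex_vector.dependent G"
  proof
    assume "complex_vector.dependent G"
    then obtain a where a: "a \<in> G" "a \<in> cspan (G - {a})"
      by (auto simp: complex_vector.dependent_def)
    have "cspan (G - {a}) \<subseteq> {y. cinner y a = 0}"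
    proof (rule complex_vector.span_minimal)
      show "G - {a} \<subseteq> {y. cinner y a = 0}" using Gorth a(1) by auto
      show "csubspace {y. cinner y a = 0}"
        by (rule complex_vector.subspaceI) (auto simp: cinner_add_left cinner_scaleC_left)
    qed
    then show False using a G(1)[OF a(1)] by (auto simp: cinner_self)
  qed
  then have "\<not> cfinite_dim (cspan G)"
    using complex_vector.independent_span_bound[of _ G] complex_vector.span_superset[of G]
      inf inj finite_imageD[of v X] unfolding cfinite_dim_def G_def by metis
  then obtain x where x: "x \<in> cspan G" "norm x = 1" "\<And>s. s \<in> S \<Longrightarrow> cinner x s = 0"
    using infinite_dim_meets_perp[OF complex_vector.subspace_span _ S(1)] by blast
  have "norm (T x) \<le> b * norm x" by (rule S(2), rule perp_if_cinner_zero, rule x(3))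
  moreover have "b * norm x < norm (T x)"
  proof (rule norm_gt_on_orthogonal_closed_span[OF bcl b G(2) Gorth])
    show "x \<in> closure (cspan G)" using x(1) closure_subset by blast
    show "x \<noteq> 0" using x(2) by auto
  qed
  ultimately show False by simp
qed

end

section \<open>Positive operators on infinite-dimensional spaces\<close>

locale positive_operator = selfadjoint_operator T for T :: "'a::chilbert_space \<Rightarrow> 'a" +
  assumes positive: "0 \<le> inner (T x) x"
    and infinite_dim: "\<not> cfinite_dim (UNIV :: 'a set)"
begin

lemma unit_vector_in_perp:
  fixes S :: "'a set"
  assumes "finite S" obtains x where "x \<in> perp S" "norm x = 1"
  using infinite_dim_meets_perp[OF complex_vector.subspace_UNIV infinite_dim assms]
    perp_if_cinner_zero by metis

lemma weyl_nonneg: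
  assumes "weyl T l" shows "0 \<le> l"
proof (rule ccontr)
  assume "\<not> 0 \<le> l"
  then obtain x where x: "norm x = 1" "norm (T x - l *\<^sub>R x) < - l"
    using weylE[OF assms finite.emptyI, of "- l"] by auto
  have "- l \<le> inner (T x - l *\<^sub>R x) x"
    using positive[of x] x(1) by (simp add: inner_diff_left power2_norm_eq_inner[symmetric])
  also have "\<dots> \<le> norm (T x - l *\<^sub>R x)"
    using norm_cauchy_schwarz[of "T x - l *\<^sub>R x" x] x(1) by simp
  finally show False using x(2) by simp
qed

lemma inner_T_le: "inner (T x) x \<le> onorm T * (norm x)\<^sup>2"
proof -
  have "inner (T x) x \<le> norm (T x) * norm x" by (rule norm_cauchy_schwarz)
  also have "\<dots> \<le> onorm T * norm x * norm x"
    by (intro mult_right_mono onorm T.bounded_linear_axioms) auto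
  finally show ?thesis by (simp add: power2_eq_square mult.assoc)
qed

text \<open>
  The bottom of the essential spectrum by a minimax principle: \<open>\<gamma>\<close> is the supremum of all \<open>c\<close> such
  that \<open>inner (T x) x \<ge> c\<close> holds for unit vectors outside finitely many directions. For \<open>c\<close> slightly
  below \<open>\<gamma>\<close> the form of \<open>T - c\<close> is nonnegative on some \<open>perp S1\<close>. Outside any finitely many directions
  there are unit vectors at which this form is small, and being orthogonal also to \<open>T ` S1\<close> they are
  mapped into \<open>perp S1\<close>, so that \<open>symmetric_form_bound\<close> makes them approximate eigenvectors.
  In particular the essential spectrum is not empty, because the dimension is infinite.
\<close>

lemma least_weyl_value:
  obtains \<gamma> where "weyl T \<gamma>"
    "\<forall>c<\<gamma>. \<exists>S. finite S \<and> (\<forall>x\<in>perp S. c * norm x \<le> norm (T x))"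
proof -
  define \<Gamma> where "\<Gamma> = {c. \<exists>S. finite S \<and> (\<forall>x\<in>perp S. c * (norm x)\<^sup>2 \<le> inner (T x) x)}"
  define \<gamma> where "\<gamma> = Sup \<Gamma>"
  have "0 \<in> \<Gamma>" unfolding \<Gamma>_def using positive by (auto intro: exI[of _ "{}"])
  then have ne: "\<Gamma> \<noteq> {}" by auto
  have "c \<le> onorm T" if c: "c \<in> \<Gamma>" for c
  proof -
    obtain S where S: "finite S" "\<And>x. x \<in> perp S \<Longrightarrow> c * (norm x)\<^sup>2 \<le> inner (T x) x"
      using c unfolding \<Gamma>_def by blast
    obtain x where "x \<in> perp S" "norm x = 1" using unit_vector_in_perp[OF S(1)] .
    then show ?thesis using S(2)[of x] inner_T_le[of x] by simp
  qed
  then have bdd: "bdd_above \<Gamma>" by (rule bdd_aboveI)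
  have below: "\<exists>c'\<in>\<Gamma>. c < c'" if "c < \<gamma>" for c
    using that unfolding \<gamma>_def less_cSup_iff[OF ne bdd] .
  have "weyl T \<gamma>"
    unfolding weyl_def
  proof (intro allI impI)
    fix S0 :: "'a set" and e :: real assume S0: "finite S0" and e: "e > 0"
    define K where "K = onorm T + \<bar>\<gamma>\<bar> + 1"
    have K: "K > 0" using onorm_pos_le[OF T.bounded_linear_axioms] by (simp add: K_def)
    \<comment> \<open>chosen so that \<open>K * (2 * \<delta>) \<le> (e / 2)\<^sup>2\<close>; \<open>K\<close> bounds the form of \<open>T - c\<close>, as \<open>- c \<le> \<bar>\<gamma>\<bar> + 1\<close>\<close>
    define \<delta> where "\<delta> = min (min 1 (e / 2)) (e\<^sup>2 / (8 * K))"
    have \<delta>: "\<delta> > 0" "\<delta> \<le> 1" "\<delta> \<le> e / 2" "\<delta> \<le> e\<^sup>2 / (8 * K)" using e K by (auto simp: \<delta>_def)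
    obtain c where c: "c \<in> \<Gamma>" "\<gamma> - \<delta> < c" using below[of "\<gamma> - \<delta>"] \<delta> by auto
    have c\<gamma>: "c \<le> \<gamma>" unfolding \<gamma>_def using c(1) bdd by (rule cSup_upper)
    obtain S1 where S1: "finite S1" "\<And>x. x \<in> perp S1 \<Longrightarrow> c * (norm x)\<^sup>2 \<le> inner (T x) x"
      using c(1) unfolding \<Gamma>_def by blast
    define S2 where "S2 = S0 \<union> S1 \<union> T ` S1"
    have "\<gamma> + \<delta> \<notin> \<Gamma>" using cSup_upper[OF _ bdd, of "\<gamma> + \<delta>"] \<delta> by (auto simp: \<gamma>_def)
    moreover have "finite S2" using S0 S1 by (simp add: S2_def)
    ultimately obtain y where y: "y \<in> perp S2" "inner (T y) y < (\<gamma> + \<delta>) * (norm y)\<^sup>2"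
      unfolding \<Gamma>_def by (auto simp: not_le)
    then have y0: "y \<noteq> 0" by auto
    define x where "x = (1 / norm y) *\<^sub>R y"
    have x: "x \<in> perp S2" "norm x = 1"
      unfolding x_def using normalize_in_subspace[OF subspace_perp y(1) y0] by auto
    have xf: "inner (T x) x < \<gamma> + \<delta>"
      using y y0 by (simp add: x_def T.scaleR power2_eq_square field_simps)
    define D where "D z = T z - c *\<^sub>R z" for z
    interpret D: selfadjoint_operator D unfolding D_def by (rule shift)
    have x1: "x \<in> perp S1" "x \<in> perp S0" "\<And>s. s \<in> S1 \<Longrightarrow> inner x (T s) = 0"
      using x(1) by (auto simp: perp_def S2_def)
    have form: "inner (D z) z = inner (T z) z - c * (norm z)\<^sup>2" for z
      by (simp add: D_def inner_diff_left power2_norm_eq_inner)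
    have "(norm (D x))\<^sup>2 \<le> K * inner (D x) x"
    proof (rule symmetric_form_bound[OF D.T.linear_axioms D.inner_T subspace_perp x1(1)])
      show "D x \<in> perp S1"
        using x1 by (auto simp: D_def perp_def inner_diff_left inner_T)
      show "0 \<le> inner (D z) z" if "z \<in> perp S1" for z using S1(2)[OF that] by (simp add: form)
      show "0 \<le> K" using K by simp
      show "inner (D z) z \<le> K * (norm z)\<^sup>2" for z
      proof -
        have "- c \<le> \<bar>\<gamma>\<bar> + 1" using c \<delta> by simp
        then have "- c * (norm z)\<^sup>2 \<le> (\<bar>\<gamma>\<bar> + 1) * (norm z)\<^sup>2" by (intro mult_right_mono) auto
        then show ?thesis using inner_T_le[of z] by (simp add: form K_def algebra_simps)
      qed
    qed
    also have "\<dots> < K * (2 * \<delta>)"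
      using xf c x K by (intro mult_strict_left_mono) (auto simp: form)
    also have "\<dots> \<le> (e / 2)\<^sup>2" using \<delta>(4) K by (simp add: field_simps power2_eq_square)
    finally have "norm (D x) < e / 2" by (rule power_less_imp_less_base) (use e in simp)
    moreover have "norm (T x - \<gamma> *\<^sub>R x) \<le> norm (D x) + norm ((\<gamma> - c) *\<^sub>R x)"
      using norm_triangle_ineq4[of "D x" "(\<gamma> - c) *\<^sub>R x"] by (simp add: D_def algebra_simps)
    moreover have "norm ((\<gamma> - c) *\<^sub>R x) < \<delta>" using x c c\<gamma> by simp
    ultimately have "norm (T x - \<gamma> *\<^sub>R x) < e" using \<delta>(3) by simp
    then show "\<exists>x\<in>perp S0. norm x = 1 \<and> norm (T x - \<gamma> *\<^sub>R x) < e" using x x1 by blast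
  qed
  moreover have "\<exists>S. finite S \<and> (\<forall>x\<in>perp S. c * norm x \<le> norm (T x))" if "c < \<gamma>" for c
  proof -
    obtain c' where c': "c' \<in> \<Gamma>" "c < c'" using below[OF \<open>c < \<gamma>\<close>] by blast
    obtain S where S: "finite S" "\<And>x. x \<in> perp S \<Longrightarrow> c' * (norm x)\<^sup>2 \<le> inner (T x) x"
      using c'(1) unfolding \<Gamma>_def by blast
    have "c * norm x \<le> norm (T x)" if "x \<in> perp S" for x
    proof (cases "x = 0")
      case False
      have "c * (norm x)\<^sup>2 \<le> c' * (norm x)\<^sup>2" using c' by (intro mult_right_mono) auto
      also have "\<dots> \<le> norm (T x) * norm x"
        using S(2)[OF that] norm_cauchy_schwarz[of "T x" x] by simp
      finally show ?thesis using False by (simp add: power2_eq_square)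
    qed simp
    then show ?thesis using S(1) by blast
  qed
  ultimately show thesis using that by blast
qed

lemma norm_T_between:
  assumes "norm (T x - l *\<^sub>R x) < e" "norm x = 1" "0 \<le> l"
  shows "norm (T x) < l + e" "l - e < norm (T x)"
  using assms norm_triangle_ineq2[of "T x" "l *\<^sub>R x"] norm_triangle_ineq3[of "T x" "l *\<^sub>R x"]
  by auto

text \<open>
  Outside any finitely many directions \<open>norm (T x)\<close> takes, on unit vectors, values near \<open>a\<close> and values
  near \<open>b\<close>, hence by connectedness every value in between. This contradicts the gap just above
  the level \<open>a + h\<close> between them.
\<close>

lemma weyl_value_unique_if_absolutely_min_attaining:
  assumes AM: "absolutely_min_attaining T" and ab: "weyl T a" "weyl T b"
  shows "\<not> a < b"
proof
  assume less: "a < b"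
  have a0: "0 \<le> a" "0 \<le> b" using ab weyl_nonneg by auto
  define h where "h = (b - a) / 4"
  have h: "h > 0" "b = a + 4 * h" using less by (auto simp: h_def field_simps)
  obtain S e where S: "finite S" "e > 0"
    "\<And>x. x \<in> perp S \<Longrightarrow> norm x = 1 \<Longrightarrow> a + h < norm (T x) \<Longrightarrow> a + h + e \<le> norm (T x)"
    using absolutely_min_attaining_gap[OF AM, of "a + h"] a0 h by auto
  obtain x where x: "x \<in> perp S" "norm x = 1" "norm (T x - a *\<^sub>R x) < h"
    using weylE[OF ab(1) S(1) h(1)] .
  obtain y where y: "y \<in> perp S" "norm y = 1" "norm (T y - b *\<^sub>R y) < h"
    using weylE[OF ab(2) S(1) h(1)] .
  define m where "m = a + h + min (e / 2) h"
  have "norm (T x) < m" using norm_T_between(1)[OF x(3,2) a0(1)] S(2) h by (simp add: m_def)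
  moreover have "m < norm (T y)"
    using norm_T_between(2)[OF y(3,2) a0(2)] h min.cobounded2[of "e / 2" h] by (simp add: m_def)
  ultimately obtain z where "z \<in> perp S" "norm z = 1" "norm (T z) = m"
    using intermediate_norm[OF T.bounded_linear_axioms subspace_perp x(1) y(1) x(2) y(2)] by blast
  then show False using S(2) S(3)[of z] h by (auto simp: m_def min_def split: if_splits)
qed

text \<open>
  Just above \<open>l\<close> there is a gap in the values of \<open>norm (T x)\<close>. These values form an interval that
  contains points below the upper end of the gap, so none of them lies beyond the gap.
\<close>

lemma norm_le_on_perp_if_absolutely_min_attaining:
  assumes AM: "absolutely_min_attaining T" and l: "weyl T l"
  obtains S where "finite S" "\<And>x. x \<in> perp S \<Longrightarrow> norm (T x) \<le> l * norm x"
proof -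
  have l0: "0 \<le> l" using l by (rule weyl_nonneg)
  obtain S e where S: "finite S" "e > 0"
    "\<And>x. x \<in> perp S \<Longrightarrow> norm x = 1 \<Longrightarrow> l < norm (T x) \<Longrightarrow> l + e \<le> norm (T x)"
    using absolutely_min_attaining_gap[OF AM l0] by blast
  have e2: "e / 2 > 0" using S by simp
  obtain x where x: "x \<in> perp S" "norm x = 1" "norm (T x - l *\<^sub>R x) < e / 2"
    using weylE[OF l S(1) e2] .
  have 1: "norm (T y) \<le> l" if y: "y \<in> perp S" "norm y = 1" for y
  proof (rule ccontr)
    assume "\<not> norm (T y) \<le> l"
    then have "l + e / 2 < norm (T y)" using S(2) S(3)[OF y] by simp
    moreover have "norm (T x) < l + e / 2" using norm_T_between(1)[OF x(3,2) l0] .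
    ultimately obtain z where "z \<in> perp S" "norm z = 1" "norm (T z) = l + e / 2"
      using intermediate_norm[OF T.bounded_linear_axioms subspace_perp x(1) y(1) x(2) y(2)] by blast
    then show False using S(2) S(3)[of z] by simp
  qed
  have "norm (T y) \<le> l * norm y" if y: "y \<in> perp S" for y
  proof (cases "y = 0")
    case False
    show ?thesis
      using 1[OF normalize_in_subspace[OF subspace_perp y False]] False
      by (simp add: T.scaleR field_simps)
  qed (simp add: T.zero)
  then show thesis using that S(1) by blast
qed

text \<open>
  Spectral points above \<open>b\<close> are discrete, so the finitely many eigenvalues above \<open>b\<close> have
  finite-dimensional eigenspaces, and these are spanned by a finite set \<open>S\<close>. The supremum \<open>s\<close> of the form
  on unit vectors of \<open>perp S\<close>, which \<open>T\<close> leaves invariant, is an approximate eigenvalue with approximate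
  eigenvectors in \<open>perp S\<close>. If it exceeded \<open>b\<close>, it would be one of the isolated eigenvalues, and
  \<open>T - s\<close> would be bounded below on \<open>perp S\<close>, which is orthogonal to its eigenspace.
\<close>

lemma norm_le_on_perp_if_finitely_many_eigenvalues:
  assumes b: "0 \<le> b" and weyl_le: "\<And>l. weyl T l \<Longrightarrow> l \<le> b"
    and fin: "finite {t. t \<in> {b<..onorm T} \<and> eigenvalue_op T (complex_of_real t)}"
  obtains S where "finite S" "\<And>x. x \<in> perp S \<Longrightarrow> norm (T x) \<le> b * norm x"
proof -
  define X where "X = {t. t \<in> {b<..onorm T} \<and> eigenvalue_op T (complex_of_real t)}"
  have disc: "complex_of_real t \<in> discrete_spectrum T"
    if "complex_of_real t \<in> spectrum_op T" "b < t" for t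
    using spectrum_imp_weyl_or_discrete[OF that(1)] weyl_le[of t] that(2) by auto
  have "\<exists>B. \<forall>t\<in>X. finite (B t) \<and> span (B t) = eigenspace_op T (complex_of_real t)"
  proof (rule bchoice, rule ballI)
    fix t assume "t \<in> X"
    then have "complex_of_real t \<in> discrete_spectrum T"
      by (intro disc eigenvalue_in_spectrum) (auto simp: X_def)
    then have "cfinite_dim (eigenspace_op T (complex_of_real t))"
      by (simp add: discrete_spectrum_def)
    then show "\<exists>B. finite B \<and> span B = eigenspace_op T (complex_of_real t)"
      using cfinite_dim_realE by metis
  qed
  then obtain B where B: "\<And>t. t \<in> X \<Longrightarrow> finite (B t)"
    "\<And>t. t \<in> X \<Longrightarrow> span (B t) = eigenspace_op T (complex_of_real t)" by blast
  define S where "S = (\<Union>t\<in>X. B t)"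
  have S: "finite S" using fin B(1) by (auto simp: S_def X_def)
  have perp_iff: "x \<in> perp S \<longleftrightarrow> (\<forall>t\<in>X. x \<in> perp (eigenspace_op T (complex_of_real t)))" for x
  proof -
    have "x \<in> perp S \<longleftrightarrow> (\<forall>t\<in>X. x \<in> perp (B t))" by (auto simp: perp_def S_def)
    also have "\<dots> \<longleftrightarrow> (\<forall>t\<in>X. x \<in> perp (eigenspace_op T (complex_of_real t)))"
      by (simp add: B(2)[symmetric] perp_span)
    finally show ?thesis .
  qed
  have TS: "T x \<in> perp S" if "x \<in> perp S" for x
    using that unfolding perp_iff
    by (auto simp: perp_def eigenspace_op_def inner_T scaleR_scaleC[symmetric])
  define E where "E = {inner (T x) x |x. x \<in> perp S \<and> norm x = 1}"
  define s where "s = Sup E"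
  obtain x0 where x0: "x0 \<in> perp S" "norm x0 = 1" using unit_vector_in_perp[OF S] .
  have E0: "E \<noteq> {}" using x0 by (auto simp: E_def)
  have "c \<le> onorm T" if c: "c \<in> E" for c
  proof -
    obtain x where "norm x = 1" "c = inner (T x) x" using c by (auto simp: E_def)
    then show ?thesis using inner_T_le[of x] by simp
  qed
  then have bdd: "bdd_above E" by (rule bdd_aboveI)
  have les: "inner (T x) x \<le> s * (norm x)\<^sup>2" if x: "x \<in> perp S" for x
  proof (cases "x = 0")
    case False
    have "inner (T ((1 / norm x) *\<^sub>R x)) ((1 / norm x) *\<^sub>R x) \<in> E"
      unfolding E_def using normalize_in_subspace[OF subspace_perp x False] by blast
    then have "inner (T ((1 / norm x) *\<^sub>R x)) ((1 / norm x) *\<^sub>R x) \<le> s"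
      unfolding s_def using bdd by (rule cSup_upper)
    then show ?thesis using False by (simp add: T.scaleR field_simps power2_eq_square)
  qed simp
  have sb: "s \<le> b"
  proof (rule ccontr)
    assume "\<not> s \<le> b"
    then have s: "b < s" "0 < s" using b by auto
    define D where "D z = s *\<^sub>R z - T z" for z
    have Dlin: "linear D" unfolding D_def
      by (intro linear_compose_sub linear_scale_self T.linear_axioms)
    have Dsym: "inner (D u) v = inner u (D v)" for u v
      by (simp add: D_def inner_diff_left inner_diff_right inner_T)
    have form: "inner (D z) z = s * (norm z)\<^sup>2 - inner (T z) z" for z
      by (simp add: D_def inner_diff_left power2_norm_eq_inner)
    have approx: "\<exists>x\<in>perp S. norm x = 1 \<and> norm (T x - s *\<^sub>R x) < e" if e: "e > 0" for e
    proof -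
      have "s - e\<^sup>2 / s < Sup E" using e s by (simp add: s_def[symmetric])
      then obtain x where x: "x \<in> perp S" "norm x = 1" "s - e\<^sup>2 / s < inner (T x) x"
        using less_cSup_iff[OF E0 bdd] by (auto simp: E_def)
      have "(norm (D x))\<^sup>2 \<le> s * inner (D x) x"
      proof (rule symmetric_form_bound[OF Dlin Dsym subspace_perp x(1)])
        show "D x \<in> perp S" unfolding D_def
          using x(1) TS by (intro subspace_diff subspace_scale subspace_perp) auto
      qed (use les positive s in \<open>auto simp: form\<close>)
      also have "\<dots> < s * (e\<^sup>2 / s)"
        using x s by (intro mult_strict_left_mono) (auto simp: form)
      also have "\<dots> = e\<^sup>2" using s by simp
      finally have "norm (D x) < e" using e by (simp add: power_less_imp_less_base)
      then show ?thesis using x by (auto simp: D_def norm_minus_commute)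
    qed
    have "complex_of_real s \<in> spectrum_op T"
      unfolding real_spectrum_iff
    proof
      assume "bounded_below (\<lambda>x. T x - s *\<^sub>R x)"
      then obtain c where c: "c > 0" "\<And>x. c * norm x \<le> norm (T x - s *\<^sub>R x)"
        by (auto simp: bounded_below_def)
      obtain x where "norm x = 1" "norm (T x - s *\<^sub>R x) < c" using approx[OF c(1)] by blast
      then show False using c(2)[of x] by simp
    qed
    then have ds: "complex_of_real s isolated_in spectrum_op T" "eigenvalue_op T (complex_of_real s)"
      using disc s by (auto simp: discrete_spectrum_def)
    then have sX: "s \<in> X" using eigenvalue_in_spectrum(2)[OF ds(2)] s by (simp add: X_def)
    obtain d where d: "d > 0" "\<And>x. x \<in> perp (eigenspace_op T (complex_of_real s))
        \<Longrightarrow> d * norm x \<le> norm (T x - s *\<^sub>R x)"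
      using isolated_bounded_below_off_eigenspace[OF ds(1)] by blast
    obtain x where "x \<in> perp S" "norm x = 1" "norm (T x - s *\<^sub>R x) < d"
      using approx[OF d(1)] by blast
    moreover from this have "x \<in> perp (eigenspace_op T (complex_of_real s))"
      using sX unfolding perp_iff by (elim conjE bspec)
    ultimately show False using d(2)[of x] by simp
  qed
  have form_le: "inner (T x) x \<le> b * (norm x)\<^sup>2" if "x \<in> perp S" for x
    using les[OF that] sb mult_right_mono[OF sb, of "(norm x)\<^sup>2"] by simp
  have "norm (T x) \<le> b * norm x" if x: "x \<in> perp S" for x
  proof -
    have "(norm (T x))\<^sup>2 \<le> b * inner (T x) x"
      by (rule symmetric_form_bound[OF T.linear_axioms inner_T subspace_perp x TS[OF x]])
        (use form_le positive b in auto)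
    also have "\<dots> \<le> b * (b * (norm x)\<^sup>2)" using form_le[OF x] b by (rule mult_left_mono)
    also have "\<dots> = (b * norm x)\<^sup>2" by (simp add: power2_eq_square)
    finally show ?thesis by (rule power2_le_imp_le) (use b in simp)
  qed
  then show thesis using that S by blast
qed

text \<open>
  An infinite-dimensional \<open>M\<close> contains a unit vector orthogonal to \<open>S\<close>, so its minimum modulus \<open>m\<close> is
  at most \<open>b\<close>. If \<open>m = b\<close>, that vector attains it. If \<open>m < b\<close>, the lower bound at a level between
  \<open>m\<close> and \<open>b\<close> makes minimizing sequences converge.
\<close>

lemma absolutely_min_attaining_if_squeezed:
  assumes lower: "\<forall>c<b. \<exists>S. finite S \<and> (\<forall>x\<in>perp S. c * norm x \<le> norm (T x))"
    and upper: "finite S" "\<And>x. x \<in> perp S \<Longrightarrow> norm (T x) \<le> b * norm x"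
  shows "absolutely_min_attaining T"
  unfolding absolutely_min_attaining_def
proof (intro conjI allI impI bcl)
  fix M :: "'a set" assume M: "csubspace M \<and> closed M \<and> M \<noteq> {0}"
  then have Ms: "subspace M" by (blast intro: csubspace_imp_subspace)
  define m where "m = min_modulus_on M T"
  have m: "m = Inf {norm (T x) |x. x \<in> M \<and> norm x = 1}"
    by (simp add: m_def min_modulus_on_def)
  have mle: "m \<le> norm (T x)" if "x \<in> M" "norm x = 1" for x
    unfolding m by (rule cInf_lower) (use that in \<open>auto intro: bdd_belowI[of _ 0]\<close>)
  have "\<exists>x\<in>M. norm x = 1 \<and> norm (T x) = m"
  proof (cases "cfinite_dim M")
    case True
    then obtain B where B: "finite B" "span B = M" by (rule cfinite_dim_realE)
    have "(m + 1) * norm y \<le> norm (T y)" if y: "y \<in> M" "y \<in> perp B" for y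
    proof -
      have "y \<in> perp M" using y(2) B(2) perp_span[of B] by simp
      then have "inner y y = 0" using y(1) by (rule perpD)
      then show ?thesis by simp
    qed
    then show ?thesis
      using B(1) span_superset[of B, unfolded B(2)] M m
      by (intro infimum_attained[OF T.bounded_linear_axioms Ms _ _ Ms, of B m "m + 1"]) auto
  next
    case False
    obtain x where x: "x \<in> M" "norm x = 1" "\<And>s. s \<in> S \<Longrightarrow> cinner x s = 0"
      using infinite_dim_meets_perp[OF _ False upper(1)] M by blast
    have xb: "norm (T x) \<le> b" using upper(2)[OF perp_if_cinner_zero[OF x(3)]] x(2) by simp
    show ?thesis
    proof (cases "m < b")
      case True
      then obtain S' where S': "finite S'" "\<forall>x\<in>perp S'. (m + b) / 2 * norm x \<le> norm (T x)"
        using lower[rule_format, of "(m + b) / 2"] by auto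
      \<comment> \<open>the midpoint lies strictly above \<open>m\<close>, as \<open>infimum_attained\<close> requires\<close>
      show ?thesis
        using True S' M
        by (intro infimum_attained[OF T.bounded_linear_axioms Ms _ _ subspace_UNIV, of S' m "(m + b) / 2"])
          (auto simp: m)
    next
      case False
      then show ?thesis using mle[OF x(1,2)] xb x by force
    qed
  qed
  then show "min_attaining_on M T" by (auto simp: min_attaining_on_def m_def)
qed

end

section \<open>The characterization\<close>

theorem theorem3p11:
  fixes T :: "'a::chilbert_space \<Rightarrow> 'a"
  assumes "\<not> cfinite_dim (UNIV :: 'a set)"
    and "bounded_clinear T"
    and "positive_op T"
  shows "absolutely_min_attaining T \<longleftrightarrow>
    is_singleton (essential_spectrum T) \<and>
    finite {t :: real. t \<in> {ess_min_modulus T <.. onorm T} \<and> eigenvalue_op T (complex_of_real t)}"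
proof -
  interpret positive_operator T
  proof
    show "0 \<le> inner (T x) x" for x
      using assms(3) by (auto simp: positive_op_def inner_eq_Re_cinner complex_nonneg_Reals_iff)
  qed (use assms in \<open>auto simp: positive_op_def\<close>)
  obtain \<gamma> where \<gamma>: "weyl T \<gamma>"
    and lower: "\<forall>c<\<gamma>. \<exists>S. finite S \<and> (\<forall>x\<in>perp S. c * norm x \<le> norm (T x))"
    using least_weyl_value .
  have \<gamma>0: "0 \<le> \<gamma>" using \<gamma> by (rule weyl_nonneg)
  have ess: "complex_of_real \<gamma> \<in> essential_spectrum T" using \<gamma> by (rule weyl_imp_essential)
  have me: "ess_min_modulus T = \<gamma>" if "essential_spectrum T = {complex_of_real \<gamma>}"
    using that \<gamma>0 by (simp add: ess_min_modulus_def)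
  show ?thesis
  proof
    assume AM: "absolutely_min_attaining T"
    have "l = \<gamma>" if "weyl T l" for l
      using weyl_value_unique_if_absolutely_min_attaining[OF AM] that \<gamma> by (meson linorder_neqE)
    then have "{l. weyl T l} = {\<gamma>}" using \<gamma> by blast
    then have single: "essential_spectrum T = {complex_of_real \<gamma>}"
      by (simp add: essential_spectrum_eq_weyl)
    obtain S where "finite S" "\<And>x. x \<in> perp S \<Longrightarrow> norm (T x) \<le> \<gamma> * norm x"
      using norm_le_on_perp_if_absolutely_min_attaining[OF AM \<gamma>] by blast
    then have "finite {t. \<gamma> < t \<and> eigenvalue_op T (complex_of_real t)}"
      using \<gamma>0 by (rule finitely_many_eigenvalues_above)
    then have "finite {t. t \<in> {\<gamma><..onorm T} \<and> eigenvalue_op T (complex_of_real t)}"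
      by (rule rev_finite_subset) auto
    then show "is_singleton (essential_spectrum T) \<and>
      finite {t :: real. t \<in> {ess_min_modulus T <.. onorm T} \<and> eigenvalue_op T (complex_of_real t)}"
      using single me by (simp add: is_singleton_def)
  next
    assume R: "is_singleton (essential_spectrum T) \<and>
      finite {t :: real. t \<in> {ess_min_modulus T <.. onorm T} \<and> eigenvalue_op T (complex_of_real t)}"
    then have single: "essential_spectrum T = {complex_of_real \<gamma>}"
      using ess by (auto simp: is_singleton_def)
    then have "l \<le> \<gamma>" if "weyl T l" for l
      using weyl_imp_essential[OF that] by simp
    moreover have "finite {t. t \<in> {\<gamma><..onorm T} \<and> eigenvalue_op T (complex_of_real t)}"
      using R me[OF single] by simp
    ultimately obtain S where "finite S" "\<And>x. x \<in> perp S \<Longrightarrow> norm (T x) \<le> \<gamma> * norm x"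
      using norm_le_on_perp_if_finitely_many_eigenvalues[OF \<gamma>0] by blast
    with lower show "absolutely_min_attaining T"
      by (rule absolutely_min_attaining_if_squeezed)
  qed
qed

end
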